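(* Let $(R,\mathfrak m,k)$ be an artinian local ring with $\operatorname{edim}R=2$. (1) If $\ell(R)<2\operatorname{r}(R)(\operatorname{r}(R)+1)$, then $\operatorname{Burch}(R)\ge1$, i.e. $R$ is Burch. (2) If $\ell(R)<\operatorname{r}(R)(\operatorname{r}(R)+1)$, then $\operatorname{Burch}(R)=2$.
   Context: $\operatorname{r}(R)=\dim_k\operatorname{soc}R$ is the type. Burch index: for a local ring $R$ of depth zero that is not a field, write $\widehat R\cong S/I$ with $(S,\mathfrak n)$ regular local; $\operatorname{Burch}(R)=\ell_S(\mathfrak n/(\mathfrak nI:(I:\mathfrak n)))$, independent of choices. $R$ is Burch if there are a maximal $\widehat R$-regular sequence $\mathbf x$, a regular local ring $S$ and an ideal $I$ with $\mathfrak n(I:\mathfrak n)\ne\mathfrak nI$ such that $\widehat R/(\mathbf x)\cong S/I$; for depth zero non-field rings this is equivalent to $\operatorname{Burch}(R)>0$. *)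

theory Defs
  imports "HOL-Algebra.Ideal_Product" "HOL-Algebra.QuotRing" "HOL-Algebra.Ring_Divisibility"
          "HOL-Library.Extended_Nat"
begin

definition colon_ideal :: "('a, 'b) ring_scheme \<Rightarrow> 'a set \<Rightarrow> 'a set \<Rightarrow> 'a set" where
  "colon_ideal R J K = {x \<in> carrier R. \<forall>y \<in> K. x \<otimes>\<^bsub>R\<^esub> y \<in> J}"

definition ideal_chain :: "('a, 'b) ring_scheme \<Rightarrow> (nat \<Rightarrow> 'a set) \<Rightarrow> nat \<Rightarrow> bool" where
  "ideal_chain R c n \<longleftrightarrow> (\<forall>i\<le>n. ideal (c i) R) \<and> (\<forall>i<n. c i \<subset> c (Suc i))"

text \<open>For ideals J \<subseteq> K of R, the R-submodules of K/J are exactly the I/J with J \<subseteq> I \<subseteq> K an ideal,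
  so the length of the R-module K/J is the supremum of lengths of strict ideal chains from J to K
  (in enat; infinite length = \<infinity>).\<close>
definition qlength :: "('a, 'b) ring_scheme \<Rightarrow> 'a set \<Rightarrow> 'a set \<Rightarrow> enat" where
  "qlength R K J = Sup {enat n | n. \<exists>c. ideal_chain R c n \<and> c 0 = J \<and> c n = K}"

definition local_ring :: "('a, 'b) ring_scheme \<Rightarrow> bool" where
  "local_ring R \<longleftrightarrow> cring R \<and> (\<exists>!m. maximalideal m R)"

definition max_ideal :: "('a, 'b) ring_scheme \<Rightarrow> 'a set" where
  "max_ideal R = (THE m. maximalideal m R)"

definition artinian_ring :: "('a, 'b) ring_scheme \<Rightarrow> bool" where
  "artinian_ring R \<longleftrightarrow> ring R \<and>
     (\<forall>f :: nat \<Rightarrow> 'a set. (\<forall>i. ideal (f i) R \<and> f (Suc i) \<subseteq> f i) \<longrightarrow> (\<exists>N. \<forall>i\<ge>N. f i = f N))"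

definition ring_length :: "('a, 'b) ring_scheme \<Rightarrow> enat" where
  "ring_length R = qlength R (carrier R) {\<zero>\<^bsub>R\<^esub>}"

text \<open>Socle (0 : m) and type r(R) = dim_k soc R (= its length, as m annihilates it).\<close>
definition socle :: "('a, 'b) ring_scheme \<Rightarrow> 'a set" where
  "socle R = colon_ideal R {\<zero>\<^bsub>R\<^esub>} (max_ideal R)"

definition ring_type :: "('a, 'b) ring_scheme \<Rightarrow> enat" where
  "ring_type R = qlength R (socle R) {\<zero>\<^bsub>R\<^esub>}"

text \<open>Embedding dimension edim R = dim_k m/m^2 (= length of m/m^2).\<close>
definition edim :: "('a, 'b) ring_scheme \<Rightarrow> enat" where
  "edim R = qlength R (max_ideal R) (max_ideal R \<cdot>\<^bsub>R\<^esub> max_ideal R)"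

definition krull_dim :: "('a, 'b) ring_scheme \<Rightarrow> enat" where
  "krull_dim R = Sup {enat n | n. \<exists>P. (\<forall>i\<le>n. primeideal (P i) R) \<and> (\<forall>i<n. P i \<subset> P (Suc i))}"

definition regular_local_ring :: "('a, 'b) ring_scheme \<Rightarrow> bool" where
  "regular_local_ring S \<longleftrightarrow> local_ring S \<and> noetherian_ring S \<and> krull_dim S = edim S"

text \<open>Burch index computed from a presentation S/I with (S,n) regular local:
  \<ell>_S(n / (nI : (I : n))).\<close>
definition burch_of_presentation :: "('a, 'b) ring_scheme \<Rightarrow> 'a set \<Rightarrow> enat" where
  "burch_of_presentation S I =
     (let n = max_ideal S in qlength S n (colon_ideal S (n \<cdot>\<^bsub>S\<^esub> I) (colon_ideal S I n)))"

end

theory Submission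
  imports Defs
begin

text \<open>Choose \<open>x\<^sub>1, \<dots>, x\<^sub>d\<^sub>-\<^sub>2\<close> in \<open>I\<close> that are independent modulo the square of the maximal ideal \<open>n\<close> of
  \<open>S\<close>, and complete them by \<open>y, z\<close> to generators of \<open>n\<close>; since \<open>S\<close> is regular, the ideals
  \<open>X = (x\<^sub>1, \<dots>, x\<^sub>d\<^sub>-\<^sub>2)\<close> and \<open>Y = X + (y)\<close> are prime. For an ideal \<open>I \<supseteq> X\<close> of finite colength let
  \<open>\<mu>\<^sub>i(I)\<close> be the number of generators of \<open>z\<^sup>i(I / (yI + X))\<close>, a module over the discrete valuation ring
  \<open>S / Y\<close>. Replacing \<open>I\<close> by \<open>I : y\<close> lowers \<open>\<mu>\<^sub>i\<close> by at most one and lowers \<open>\<ell>(S / I)\<close> by at least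
  \<open>(i + 1)(\<mu>\<^sub>i(I) - 1)\<close>; hence \<open>\<mu>\<^sub>i(I) \<ge> m + 1\<close> implies \<open>2 \<ell>(S / I) \<ge> (i + 1) m (m + 1)\<close>.

  Put \<open>J = I : n\<close> and let \<open>r\<close> be the type. Always \<open>\<mu>\<^sub>0(I) \<ge> r + 1\<close>. If the Burch index vanishes, then
  \<open>nJ = nI\<close>, so \<open>\<mu>\<^sub>0(J) \<ge> 2r + 1\<close> and \<open>\<ell>(S / I) = r + \<ell>(S / J) \<ge> 2r(r + 1)\<close>. If it is not two, then
  \<open>y\<close> can be chosen with \<open>yJ \<subseteq> nI\<close>; this forces \<open>J \<subseteq> I + z(I : y)\<close>, so \<open>\<mu>\<^sub>1(I) \<ge> r + 1\<close> and
  \<open>\<ell>(S / I) \<ge> r(r + 1)\<close>.\<close>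

section \<open>Length of quotients of ideals\<close>

text \<open>Over the discrete valuation ring S / Y the module N = I / (yI + X) is an extension of a
  free module of rank one by a torsion module M isomorphic to (I : y) / I. Each of the i + 1 layers
  of N / z^(i+1) N has dimension at least \<open>\<mu>\<^sub>i\<close>, while the free part accounts
  for exactly i + 1 dimensions; the surplus must fit into M, which is why passing to I : y costs so
  much length. The type enters because the socle of M is J / I, and a torsion module of finite
  length over a discrete valuation ring needs as many generators as its socle has dimensions. The
  constants are sums of such surpluses: 2r(r + 1) = r + (1 + ... + 2r), and r(r + 1) = 2(1 + ... +
  r), where the factor 2 is i + 1 for i = 1. No quotient module is formed. Modules are intervals in
  the lattice of ideals of S, and an isomorphism becomes an equality of chain lengths. Regularity
  enters through the primality of X and Y, and this is what calls for Krull's height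
  theorem.\<close>

lemma ideal_chain_mono:
  assumes "ideal_chain R c n" "i \<le> j" "j \<le> n"
  shows "c i \<subseteq> c j"
  using assms(2,3)
proof (induction j rule: dec_induct)
  case base
  then show ?case by simp
next
  case (step j)
  then show ?case
    using assms(1) unfolding ideal_chain_def by (meson Suc_leD Suc_le_lessD order_trans psubset_imp_subset)
qed

lemma qlength_ge: "ideal_chain R c n \<Longrightarrow> enat n \<le> qlength R (c n) (c 0)"
  unfolding qlength_def by (rule Sup_upper) auto

lemma qlength_le:
  assumes "\<And>c n. ideal_chain R c n \<Longrightarrow> c 0 = J \<Longrightarrow> c n = K \<Longrightarrow> enat n \<le> b"
  shows "qlength R K J \<le> b"
  unfolding qlength_def by (rule Sup_least) (use assms in auto)

text \<open>A strictly monotone map between intervals of ideals carries strict chains to strict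
  chains. Applied in both directions it replaces the construction of a module isomorphism.\<close>

lemma qlength_mono_map:
  assumes ideal: "\<And>L. ideal L R \<Longrightarrow> J \<subseteq> L \<Longrightarrow> L \<subseteq> K \<Longrightarrow> ideal (g L) R'"
    and strict: "\<And>L M. ideal L R \<Longrightarrow> ideal M R \<Longrightarrow> J \<subseteq> L \<Longrightarrow> L \<subset> M \<Longrightarrow> M \<subseteq> K \<Longrightarrow> g L \<subset> g M"
    and "g J = J'" "g K = K'"
  shows "qlength R K J \<le> qlength R' K' J'"
proof (rule qlength_le)
  fix c n assume c: "ideal_chain R c n" "c 0 = J" "c n = K"
  have between: "J \<subseteq> c i" "c i \<subseteq> K" if "i \<le> n" for i
    using ideal_chain_mono[OF c(1)] that c(2,3) by blast+
  have "ideal_chain R' (\<lambda>i. g (c i)) n"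
    unfolding ideal_chain_def
  proof (intro conjI allI impI)
    fix i assume "i \<le> n"
    then show "ideal (g (c i)) R'"
      using ideal between c(1) unfolding ideal_chain_def by blast
  next
    fix i assume "i < n"
    then show "g (c i) \<subset> g (c (Suc i))"
      using strict between[of i] between[of "Suc i"] c(1) unfolding ideal_chain_def
      by (simp add: Suc_leI)
  qed
  from qlength_ge[OF this] show "enat n \<le> qlength R' K' J'"
    using c assms(3,4) by simp
qed

text \<open>Nonemptiness matters: the supremum of the empty set is 0, and p alone could exceed b.
  For chain lengths between nested ideals it is supplied by
  \<open>ideal_chain_exists\<close>.\<close>

lemma enat_Sup_add_le:
  fixes b p :: enat
  assumes "X \<noteq> {}" "\<And>x. x \<in> X \<Longrightarrow> x + p \<le> b"
  shows "Sup X + p \<le> b"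
proof (cases b)
  case (enat m)
  obtain x where "x \<in> X" using assms(1) by blast
  then have "x + p \<le> enat m" using assms(2) enat by blast
  then obtain q where q: "p = enat q" "q \<le> m"
    by (cases p; cases x) auto
  have "x \<le> enat (m - q)" if "x \<in> X" for x
    using assms(2)[OF that] q enat by (cases x) auto
  then have "Sup X \<le> enat (m - q)" by (rule Sup_least)
  then show ?thesis using q enat by (cases "Sup X") auto
qed simp

lemma ideal_chain_exists:
  assumes "ideal J R" "ideal K R" "J \<subseteq> K"
  shows "\<exists>n c. ideal_chain R c n \<and> c 0 = J \<and> c n = K"
proof (cases "J = K")
  case True
  have "ideal_chain R (\<lambda>_. J) 0" using assms by (simp add: ideal_chain_def)
  then show ?thesis using True by blast
next
  case False
  have "ideal_chain R (\<lambda>i. if i = 0 then J else K) 1"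
    using assms False by (auto simp: ideal_chain_def)
  then show ?thesis by (intro exI[of _ 1] exI[of _ "\<lambda>i. if i = 0 then J else K"]) simp
qed

lemma qlength_Suc_le:
  assumes "ideal J R" "ideal K R" "ideal L R" "J \<subseteq> K" "K \<subset> L"
  shows "qlength R K J + 1 \<le> qlength R L J"
proof -
  have "x + 1 \<le> qlength R L J"
    if x: "x \<in> {enat n |n. \<exists>c. ideal_chain R c n \<and> c 0 = J \<and> c n = K}" for x
  proof -
    obtain n c where c: "x = enat n" "ideal_chain R c n" "c 0 = J" "c n = K"
      using x by blast
    have "ideal_chain R (c(Suc n := L)) (Suc n)"
      using c assms unfolding ideal_chain_def by (auto simp: less_Suc_eq le_Suc_eq)
    from qlength_ge[OF this] show ?thesis
      using c by (simp add: one_enat_def)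
  qed
  moreover have "{enat n |n. \<exists>c. ideal_chain R c n \<and> c 0 = J \<and> c n = K} \<noteq> {}"
    using ideal_chain_exists[OF assms(1,2,4)] by auto
  ultimately show ?thesis
    unfolding qlength_def[of R K J] by (rule enat_Sup_add_le[rotated])
qed

lemma qlength_self [simp]: "qlength R J J = 0"
proof -
  have "qlength R J J \<le> 0"
  proof (rule qlength_le)
    fix c n assume c: "ideal_chain R c n" "c 0 = J" "c n = J"
    have "n = 0"
    proof (rule ccontr)
      assume "n \<noteq> 0"
      then have "c 0 \<subset> c 1" "c 1 \<subseteq> c n"
        using c(1) ideal_chain_mono[OF c(1), of 1 n] unfolding ideal_chain_def by auto
      then show False using c by auto
    qed
    then show "enat n \<le> 0" by (simp add: zero_enat_def)
  qed
  then show ?thesis by simp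
qed

lemma qlength_mono:
  assumes "ideal J R" "ideal K R" "ideal L R" "J \<subseteq> K" "K \<subseteq> L"
  shows "qlength R K J \<le> qlength R L J"
proof (cases "K = L")
  case False
  then have "qlength R K J + 1 \<le> qlength R L J" using qlength_Suc_le assms by blast
  then show ?thesis by (meson le_iff_add order_trans)
qed simp

lemma qlength_pos:
  assumes "ideal J R" "ideal K R" "J \<subset> K"
  shows "1 \<le> qlength R K J"
  using qlength_Suc_le[of J R J K] assms by simp

section \<open>Sums and colons of ideals, additivity of length\<close>

context ring
begin

lemma ideal_zero: "ideal I R \<Longrightarrow> \<zero> \<in> I"
  by (simp add: additive_subgroup.zero_closed ideal.axioms(1))

lemma ideal_add: "ideal I R \<Longrightarrow> a \<in> I \<Longrightarrow> b \<in> I \<Longrightarrow> a \<oplus> b \<in> I"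
  by (simp add: additive_subgroup.a_closed ideal.axioms(1))

lemma ideal_neg: "ideal I R \<Longrightarrow> a \<in> I \<Longrightarrow> \<ominus> a \<in> I"
  by (simp add: additive_subgroup.a_inv_closed ideal.axioms(1))

lemma ideal_minus: "ideal I R \<Longrightarrow> a \<in> I \<Longrightarrow> b \<in> I \<Longrightarrow> a \<ominus> b \<in> I"
  by (simp add: ideal_add ideal_neg minus_eq)

lemma ideal_lmult: "ideal I R \<Longrightarrow> a \<in> I \<Longrightarrow> x \<in> carrier R \<Longrightarrow> x \<otimes> a \<in> I"
  by (simp add: ideal.I_l_closed)

lemma ideal_rmult: "ideal I R \<Longrightarrow> a \<in> I \<Longrightarrow> x \<in> carrier R \<Longrightarrow> a \<otimes> x \<in> I"
  by (simp add: ideal.I_r_closed)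

lemma ideal_carrier: "ideal I R \<Longrightarrow> a \<in> I \<Longrightarrow> a \<in> carrier R"
  by (rule ideal.Icarr)

lemma ideal_subset: "ideal I R \<Longrightarrow> I \<subseteq> carrier R"
  by (auto dest: ideal_carrier)

lemma ideal_add_cancel:
  assumes "ideal I R" "a \<in> I" "b \<in> carrier R" "a \<oplus> b \<in> I"
  shows "b \<in> I"
proof -
  have "b = (a \<oplus> b) \<ominus> a"
    using assms ideal_carrier[OF assms(1,2)] by algebra
  then show ?thesis using assms ideal_minus by metis
qed

end

lemma (in cring) idealI':
  assumes "I \<subseteq> carrier R" "\<zero> \<in> I" "\<And>a b. a \<in> I \<Longrightarrow> b \<in> I \<Longrightarrow> a \<oplus> b \<in> I"
    "\<And>a x. a \<in> I \<Longrightarrow> x \<in> carrier R \<Longrightarrow> x \<otimes> a \<in> I"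
  shows "ideal I R"
proof (rule idealI[OF ring_axioms])
  have neg: "\<ominus> a \<in> I" if "a \<in> I" for a
  proof -
    have "\<ominus> a = (\<ominus> \<one>) \<otimes> a" using that assms(1) l_minus by auto
    then show ?thesis using assms(4)[OF that, of "\<ominus> \<one>"] by simp
  qed
  show "subgroup I (add_monoid R)"
    by (rule add.subgroupI) (use assms neg in \<open>auto simp: a_inv_def\<close>)
  show "\<And>a x. a \<in> I \<Longrightarrow> x \<in> carrier R \<Longrightarrow> a \<otimes> x \<in> I"
    using assms m_comm by (metis subsetD)
qed (use assms in auto)

text \<open>These two are aK + J and K \<inter> (J : a). With a = 1 or K the whole ring they
  specialize to sums, intersections, ideals J + (a) and colon ideals, so that one isomorphism
  theorem, \<open>qlength_comb\<close>, serves them all.\<close>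

definition comb :: "('a, 'b) ring_scheme \<Rightarrow> 'a \<Rightarrow> 'a set \<Rightarrow> 'a set \<Rightarrow> 'a set" where
  "comb R a K J = {a \<otimes>\<^bsub>R\<^esub> k \<oplus>\<^bsub>R\<^esub> j | k j. k \<in> K \<and> j \<in> J}"

definition pull :: "('a, 'b) ring_scheme \<Rightarrow> 'a \<Rightarrow> 'a set \<Rightarrow> 'a set \<Rightarrow> 'a set" where
  "pull R a K J = {f \<in> K. a \<otimes>\<^bsub>R\<^esub> f \<in> J}"

lemma combI: "k \<in> K \<Longrightarrow> j \<in> J \<Longrightarrow> a \<otimes>\<^bsub>R\<^esub> k \<oplus>\<^bsub>R\<^esub> j \<in> comb R a K J"
  unfolding comb_def by blast

lemma combE:
  assumes "f \<in> comb R a K J"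
  obtains k j where "k \<in> K" "j \<in> J" "f = a \<otimes>\<^bsub>R\<^esub> k \<oplus>\<^bsub>R\<^esub> j"
  using assms unfolding comb_def by blast

lemma comb_mono: "K \<subseteq> K' \<Longrightarrow> J \<subseteq> J' \<Longrightarrow> comb R a K J \<subseteq> comb R a K' J'"
  unfolding comb_def by blast

context cring
begin

lemma comb_ideal:
  assumes "ideal K R" "ideal J R" "a \<in> carrier R"
  shows "ideal (comb R a K J) R"
proof (rule idealI')
  note cl = ideal_carrier[OF assms(1)] ideal_carrier[OF assms(2)]
  show "comb R a K J \<subseteq> carrier R"
    using assms cl by (auto elim!: combE)
  show "\<zero> \<in> comb R a K J"
    using combI[of \<zero> K \<zero> J R a] assms by (simp add: ideal_zero)
  show "f \<oplus> g \<in> comb R a K J" if fg: "f \<in> comb R a K J" "g \<in> comb R a K J" for f g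
  proof -
    obtain k j k' j' where *: "k \<in> K" "j \<in> J" "f = a \<otimes> k \<oplus> j" "k' \<in> K" "j' \<in> J" "g = a \<otimes> k' \<oplus> j'"
      using fg by (meson combE)
    have "f \<oplus> g = a \<otimes> (k \<oplus> k') \<oplus> (j \<oplus> j')"
      using * cl assms(3) by algebra
    then show ?thesis using * assms by (auto intro!: combI ideal_add)
  qed
  show "x \<otimes> f \<in> comb R a K J" if f: "f \<in> comb R a K J" and x: "x \<in> carrier R" for f x
  proof -
    obtain k j where *: "k \<in> K" "j \<in> J" "f = a \<otimes> k \<oplus> j"
      using f by (meson combE)
    have "x \<otimes> f = a \<otimes> (x \<otimes> k) \<oplus> x \<otimes> j"
      using * cl assms(3) x by algebra
    then show ?thesis using * assms x by (auto intro!: combI ideal_lmult)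
  qed
qed

lemma pull_ideal:
  assumes "ideal K R" "ideal J R" "a \<in> carrier R"
  shows "ideal (pull R a K J) R"
proof (rule idealI')
  note cl = ideal_carrier[OF assms(1)] ideal_carrier[OF assms(2)]
  show "pull R a K J \<subseteq> carrier R"
    using cl by (auto simp: pull_def)
  show "\<zero> \<in> pull R a K J"
    using assms by (auto simp: pull_def ideal_zero)
  show "f \<oplus> g \<in> pull R a K J" if "f \<in> pull R a K J" "g \<in> pull R a K J" for f g
  proof -
    have "a \<otimes> (f \<oplus> g) = a \<otimes> f \<oplus> a \<otimes> g" 
      using that assms cl by (auto simp: pull_def r_distr)
    then show ?thesis using that assms by (auto simp: pull_def ideal_add)
  qed
  show "x \<otimes> f \<in> pull R a K J" if "f \<in> pull R a K J" "x \<in> carrier R" for f x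
  proof -
    have "a \<otimes> (x \<otimes> f) = x \<otimes> (a \<otimes> f)" 
      using that assms cl by (auto simp: pull_def m_lcomm)
    then show ?thesis using that assms by (auto simp: pull_def ideal_lmult)
  qed
qed

lemma comb_supset_right:
  assumes "ideal K R" "ideal J R" "a \<in> carrier R"
  shows "J \<subseteq> comb R a K J"
proof
  fix j assume j: "j \<in> J"
  then have "a \<otimes> \<zero> \<oplus> j = j" using assms ideal_carrier by simp
  then show "j \<in> comb R a K J" using combI[of \<zero> K j J R a] j assms ideal_zero by metis
qed

lemma comb_mult_mem:
  assumes "ideal K R" "ideal J R" "a \<in> carrier R" "k \<in> K"
  shows "a \<otimes> k \<in> comb R a K J"
proof -
  have "a \<otimes> k \<oplus> \<zero> = a \<otimes> k" using assms ideal_carrier by simp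
  then show ?thesis using combI[of k K \<zero> J R a] assms ideal_zero by metis
qed

lemma comb_least:
  assumes "ideal L R" "J \<subseteq> L" "\<And>k. k \<in> K \<Longrightarrow> a \<otimes> k \<in> L"
  shows "comb R a K J \<subseteq> L"
  using assms by (auto elim!: combE intro!: ideal_add)

text \<open>Multiplication by a maps K onto (aK + J) / J with kernel \<open>pull R a K J\<close>. On
  submodules this is the pair of maps L to \<open>pull R a K L\<close> and L to aL + J, each
  strictly monotone on its interval.\<close>

lemma qlength_comb:
  assumes K: "ideal K R" and J: "ideal J R" and a: "a \<in> carrier R"
  shows "qlength R (comb R a K J) J = qlength R K (pull R a K J)"
proof (rule antisym)
  have pull_top: "pull R a K (comb R a K J) = K"
    using comb_mult_mem[OF assms] by (auto simp: pull_def)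
  show "qlength R (comb R a K J) J \<le> qlength R K (pull R a K J)"
  proof (rule qlength_mono_map[where g = "pull R a K"])
    fix L M assume LM: "ideal L R" "ideal M R" "J \<subseteq> L" "L \<subset> M" "M \<subseteq> comb R a K J"
    obtain f where f: "f \<in> M" "f \<notin> L" using LM by blast
    then obtain k j where kj: "k \<in> K" "j \<in> J" "f = a \<otimes> k \<oplus> j" using LM by (meson combE subsetD)
    have ak: "a \<otimes> k \<in> carrier R" using kj a K ideal_carrier by blast
    have "a \<otimes> k \<in> M"
      using ideal_add_cancel[OF LM(2), of j "a \<otimes> k"] f kj LM ak J ideal_carrier a_comm by (metis psubsetD subsetD)
    moreover have "a \<otimes> k \<notin> L"
      using f kj LM ideal_add by blast
    ultimately show "pull R a K L \<subset> pull R a K M"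
      using kj LM by (auto simp: pull_def)
  qed (use assms pull_top in \<open>auto intro!: pull_ideal\<close>)
  have comb_bot: "comb R a (pull R a K J) J = J"
  proof
    show "comb R a (pull R a K J) J \<subseteq> J"
      using J by (intro comb_least) (auto simp: pull_def)
    show "J \<subseteq> comb R a (pull R a K J) J"
      by (rule comb_supset_right) (use assms pull_ideal in auto)
  qed
  show "qlength R K (pull R a K J) \<le> qlength R (comb R a K J) J"
  proof (rule qlength_mono_map[where g = "\<lambda>L. comb R a L J"])
    fix L M assume LM: "ideal L R" "ideal M R" "pull R a K J \<subseteq> L" "L \<subset> M" "M \<subseteq> K"
    obtain f where f: "f \<in> M" "f \<notin> L" using LM by blast
    have "a \<otimes> f \<in> comb R a M J" using comb_mult_mem LM J a f by blast
    moreover have "a \<otimes> f \<notin> comb R a L J"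
    proof
      assume "a \<otimes> f \<in> comb R a L J"
      then obtain k j where kj: "k \<in> L" "j \<in> J" "a \<otimes> f = a \<otimes> k \<oplus> j" by (rule combE)
      have cl: "f \<in> carrier R" "k \<in> carrier R" "j \<in> carrier R"
        using f kj LM J ideal_carrier by blast+
      have "a \<otimes> (f \<ominus> k) = a \<otimes> f \<ominus> a \<otimes> k" using cl a by algebra
      also have "\<dots> = j" unfolding kj using cl a by algebra
      finally have "f \<ominus> k \<in> pull R a K J"
        unfolding pull_def using f kj LM K by (auto intro!: ideal_minus)
      then have "k \<oplus> (f \<ominus> k) \<in> L" using LM kj ideal_add by blast
      moreover have "k \<oplus> (f \<ominus> k) = f" using cl by algebra
      ultimately show False using f by simp
    qed
    ultimately show "comb R a L J \<subset> comb R a M J"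
      using LM comb_mono[of L M J J R a] by blast
  qed (use assms comb_bot in \<open>auto intro!: comb_ideal\<close>)
qed

lemma pull_one: 
  assumes "ideal K R" shows "pull R \<one> K J = K \<inter> J"
  using assms ideal_carrier by (fastforce simp: pull_def)

lemma qlength_add_ge:
  assumes "ideal J R" "ideal L R" "ideal K R" "J \<subseteq> L" "L \<subseteq> K"
  shows "qlength R K L + qlength R L J \<le> qlength R K J"
  unfolding qlength_def[of R K L]
proof (rule enat_Sup_add_le)
  fix x assume "x \<in> {enat n |n. \<exists>c. ideal_chain R c n \<and> c 0 = L \<and> c n = K}"
  then obtain n c where c: "x = enat n" "ideal_chain R c n" "c 0 = L" "c n = K" by blast
  have "enat i + qlength R L J \<le> qlength R (c i) J" if "i \<le> n" for i
    using that
  proof (induction i)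
    case 0
    then show ?case using c by (simp add: zero_enat_def[symmetric])
  next
    case (Suc i)
    have "enat (Suc i) + qlength R L J = enat i + qlength R L J + 1"
      by (simp add: eSuc_enat[symmetric] eSuc_plus_1 ac_simps)
    also have "\<dots> \<le> qlength R (c i) J + 1"
      using Suc by (simp add: add_right_mono)
    also have "\<dots> \<le> qlength R (c (Suc i)) J"
      using c Suc.prems assms(1,4) ideal_chain_mono[OF c(2), of 0 i]
      by (intro qlength_Suc_le) (auto simp: ideal_chain_def)
    finally show ?case .
  qed
  from this[of n] show "x + qlength R L J \<le> qlength R K J" using c by simp
next
  show "{enat n |n. \<exists>c. ideal_chain R c n \<and> c 0 = L \<and> c n = K} \<noteq> {}"
    using ideal_chain_exists[OF assms(2,3,5)] by auto
qed

lemma sum_ideal_supset_left: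
  assumes "ideal K R" "ideal J R"
  shows "K \<subseteq> comb R \<one> K J"
  using comb_mult_mem[OF assms, of \<one>] ideal_carrier[OF assms(1)] by fastforce

lemma inter_ideal: "ideal K R \<Longrightarrow> ideal J R \<Longrightarrow> ideal (K \<inter> J) R"
  by (rule i_intersect)

text \<open>By the modular law, nested ideals with the same intersection with L and the same sum
  with L coincide. So every step of a chain from J to K is strict in \<open>A\<close> or in
  \<open>B\<close>, and is paid for by one of the two lengths.\<close>

lemma qlength_add_le:
  assumes "ideal J R" "ideal L R" "ideal K R" "J \<subseteq> L" "L \<subseteq> K"
  shows "qlength R K J \<le> qlength R K L + qlength R L J"
proof (rule qlength_le)
  fix c n assume c: "ideal_chain R c n" "c 0 = J" "c n = K"
  define A where "A i = c i \<inter> L" for i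
  define B where "B i = comb R \<one> (c i) L" for i
  have ci: "ideal (c i) R" if "i \<le> n" for i using c that by (auto simp: ideal_chain_def)
  have idl: "ideal (A i) R" "ideal (B i) R" if "i \<le> n" for i
    using ci[OF that] assms unfolding A_def B_def by (auto intro: inter_ideal comb_ideal)
  have sub: "J \<subseteq> A i" "L \<subseteq> B i" if "i \<le> n" for i
    using ci[OF that] ideal_chain_mono[OF c(1), of 0 i] that c assms comb_supset_right[of "c i" L \<one>]
    unfolding A_def B_def by auto
  have "enat i \<le> qlength R (B i) L + qlength R (A i) J" if "i \<le> n" for i
    using that
  proof (induction i)
    case 0
    then show ?case by (simp add: zero_enat_def[symmetric])
  next
    case (Suc i)
    have i: "i \<le> n" "c i \<subset> c (Suc i)" using Suc.prems c by (auto simp: ideal_chain_def)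
    have AA: "A i \<subseteq> A (Suc i)" and BB: "B i \<subseteq> B (Suc i)"
      using i comb_mono[of "c i" "c (Suc i)" L L R \<one>] unfolding A_def B_def by auto
    have "A i \<subset> A (Suc i) \<or> B i \<subset> B (Suc i)"
    proof (rule ccontr)
      assume "\<not> ?thesis"
      then have eq: "A i = A (Suc i)" "B i = B (Suc i)" using AA BB by auto
      obtain f where f: "f \<in> c (Suc i)" "f \<notin> c i" using i by blast
      have "f \<in> B (Suc i)"
        unfolding B_def using sum_ideal_supset_left[of "c (Suc i)" L] f ci[OF Suc.prems] assms by blast
      then have "f \<in> B i" using eq by simp
      then obtain k j where kj: "k \<in> c i" "j \<in> L" "f = \<one> \<otimes> k \<oplus> j"
        unfolding B_def by (rule combE)
      have cl: "k \<in> carrier R" "j \<in> carrier R" using kj ci[OF i(1)] assms ideal_carrier by blast+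
      have "j \<in> c (Suc i)"
        using ideal_add_cancel[OF ci[OF Suc.prems], of k j] kj f i cl by auto
      then have "j \<in> A i" using kj eq unfolding A_def by blast
      then have "f \<in> c i" using kj cl ideal_add[OF ci[OF i(1)]] by (auto simp: A_def)
      then show False using f by simp
    qed
    note ids = assms(1,2) idl[OF i(1)] idl[OF Suc.prems]
    have "qlength R (B i) L + qlength R (A i) J + 1
        \<le> qlength R (B (Suc i)) L + qlength R (A (Suc i)) J"
    proof (cases "A i \<subset> A (Suc i)")
      case True
      have "qlength R (A i) J + 1 \<le> qlength R (A (Suc i)) J"
        by (rule qlength_Suc_le) (use ids sub(1)[OF i(1)] True in auto)
      moreover have "qlength R (B i) L \<le> qlength R (B (Suc i)) L"
        by (rule qlength_mono) (use ids sub(2)[OF i(1)] BB in auto)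
      ultimately show ?thesis using add_mono by (simp add: add.assoc)
    next
      case False
      have "qlength R (B i) L + 1 \<le> qlength R (B (Suc i)) L"
        by (rule qlength_Suc_le) (use ids sub(2)[OF i(1)] False \<open>_ \<or> _\<close> in auto)
      moreover have "qlength R (A i) J \<le> qlength R (A (Suc i)) J"
        by (rule qlength_mono) (use ids sub(1)[OF i(1)] AA in auto)
      ultimately have "(qlength R (B i) L + 1) + qlength R (A i) J
          \<le> qlength R (B (Suc i)) L + qlength R (A (Suc i)) J" by (rule add_mono)
      then show ?thesis by (simp add: ac_simps)
    qed
    moreover have "enat (Suc i) \<le> qlength R (B i) L + qlength R (A i) J + 1"
      using add_right_mono[OF Suc.IH[OF i(1)], of 1] by (simp add: one_enat_def)
    ultimately show ?case by (rule order_trans[rotated])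
  qed
  from this[of n] have "enat n \<le> qlength R (B n) L + qlength R (A n) J" by simp
  moreover have "A n = L" using c assms by (auto simp: A_def)
  moreover have "B n = K"
  proof
    show "B n \<subseteq> K"
      unfolding B_def c(3) by (rule comb_least) (use assms ideal_carrier in auto)
    show "K \<subseteq> B n"
      unfolding B_def c(3) by (rule sum_ideal_supset_left) (use assms in auto)
  qed
  ultimately show "enat n \<le> qlength R K L + qlength R L J" by simp
qed

lemma qlength_add:
  assumes "ideal J R" "ideal L R" "ideal K R" "J \<subseteq> L" "L \<subseteq> K"
  shows "qlength R K J = qlength R K L + qlength R L J"
  using qlength_add_le[OF assms] qlength_add_ge[OF assms] by (rule antisym)

lemma qlength_antimono:
  assumes "ideal J R" "ideal L R" "ideal K R" "J \<subseteq> L" "L \<subseteq> K"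
  shows "qlength R K L \<le> qlength R K J"
  using qlength_add[OF assms] by (simp add: le_iff_add)

lemma qlength_comb_le:
  assumes "ideal K R" "ideal J R" "a \<in> carrier R" "ideal L R" "L \<subseteq> pull R a K J"
  shows "qlength R (comb R a K J) J \<le> qlength R K L"
  unfolding qlength_comb[OF assms(1-3)]
  using assms pull_ideal by (intro qlength_antimono) (auto simp: pull_def)

end

section \<open>Colength in a two-dimensional regular local ring\<close>

lemma qlength_maximal:
  assumes "maximalideal n R"
  shows "qlength R (carrier R) n = 1"
proof (rule antisym)
  interpret maximalideal n R by fact
  show "qlength R (carrier R) n \<le> 1"
  proof (rule qlength_le)
    fix c N assume c: "ideal_chain R c N" "c 0 = n" "c N = carrier R"
    have "\<not> 2 \<le> N"
    proof
      assume N: "2 \<le> N"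
      then have "ideal (c 1) R" "c 0 \<subset> c 1" "c 1 \<subset> c (Suc 1)" "c (Suc 1) \<subseteq> c N"
        using c(1) ideal_chain_mono[OF c(1), of 2 N] by (auto simp: ideal_chain_def numeral_2_eq_2)
      then show False using I_maximal[of "c 1"] c by auto
    qed
    then show "enat N \<le> 1" by (simp add: one_enat_def)
  qed
  show "1 \<le> qlength R (carrier R) n"
    using I_notcarr a_subset is_ideal oneideal by (intro qlength_pos) auto
qed

text \<open>In the application X, Y and n are generated by the first d - 2, d - 1 and d members of a
  regular system of parameters. Primality makes y cancellable modulo X and z cancellable modulo Y;
  as n = Y + (z), the quotient R / Y plays the role of a discrete valuation ring with uniformizer
  z.\<close>

locale two_params = cring R for R (structure) +
  fixes X Y n and y z
  assumes prime_X: "primeideal X R" and prime_Y: "primeideal Y R" and max_n: "maximalideal n R"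
    and y [simp]: "y \<in> carrier R" and z [simp]: "z \<in> carrier R"
    and Y_eq: "Y = comb R y (carrier R) X" and n_eq: "n = comb R z (carrier R) Y"
    and y_notin: "y \<notin> X" and z_notin: "z \<notin> Y"
begin

lemma ideal_X [simp]: "ideal X R" and ideal_Y [simp]: "ideal Y R" and ideal_n [simp]: "ideal n R"
  using prime_X prime_Y max_n by (simp_all add: primeideal_def maximalideal_def)

lemma X_Y: "X \<subseteq> Y"
  unfolding Y_eq by (rule comb_supset_right) (auto simp: oneideal)

lemma Y_n: "Y \<subseteq> n"
  unfolding n_eq by (rule comb_supset_right) (auto simp: oneideal)

lemma y_in_Y: "f \<in> carrier R \<Longrightarrow> y \<otimes> f \<in> Y"
  unfolding Y_eq by (rule comb_mult_mem) (auto simp: oneideal)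

lemma y_cancel: "f \<in> carrier R \<Longrightarrow> y \<otimes> f \<in> X \<Longrightarrow> f \<in> X"
  using primeideal.I_prime[OF prime_X] y_notin y by blast

lemma z_cancel: "f \<in> carrier R \<Longrightarrow> z \<otimes> f \<in> Y \<Longrightarrow> f \<in> Y"
  using primeideal.I_prime[OF prime_Y] z_notin z by blast

lemma zpow_cancel: "f \<in> carrier R \<Longrightarrow> z [^] (i::nat) \<otimes> f \<in> Y \<Longrightarrow> f \<in> Y"
proof (induction i)
  case (Suc i)
  have "z [^] Suc i \<otimes> f = z \<otimes> (z [^] i \<otimes> f)"
    using Suc.prems z by (simp add: m_ac)
  then have "z \<otimes> (z [^] i \<otimes> f) \<in> Y" using Suc.prems(2) by simp
  from z_cancel[OF _ this] have "z [^] i \<otimes> f \<in> Y" using Suc.prems(1) by simp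
  then show ?case by (rule Suc.IH[OF Suc.prems(1)])
qed simp

text \<open>Read in the discrete valuation ring \<open>R / Y\<close> with uniformizer \<open>z\<close>: although \<open>K / Y\<close> is
  principal there, only the count \<open>\<ell>(R / zK) = 1 + \<ell>(R / K)\<close> is needed.\<close>

lemma qlength_zK:
  assumes K: "ideal K R" and "Y \<subseteq> K" and fin: "qlength R (carrier R) K \<noteq> \<infinity>"
  shows "qlength R K (comb R z K Y) = 1"
proof -
  let ?W = "comb R z K Y"
  have W: "ideal ?W R" using K by (simp add: comb_ideal)
  have YW: "Y \<subseteq> ?W" using K by (simp add: comb_supset_right)
  have WK: "?W \<subseteq> K"
    using assms by (intro comb_least) (auto intro: ideal_lmult)
  have Wn: "?W \<subseteq> n" unfolding n_eq using ideal_subset[OF K] by (intro comb_mono) auto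
  have n: "n = comb R z (carrier R) ?W"
  proof
    show "n \<subseteq> comb R z (carrier R) ?W" unfolding n_eq using YW by (intro comb_mono) auto
    show "comb R z (carrier R) ?W \<subseteq> n"
      by (rule comb_least[OF ideal_n Wn]) (simp add: n_eq comb_mult_mem oneideal)
  qed
  have pull: "pull R z (carrier R) ?W = K"
  proof
    show "pull R z (carrier R) ?W \<subseteq> K"
    proof
      fix f assume "f \<in> pull R z (carrier R) ?W"
      then have f: "f \<in> carrier R" "z \<otimes> f \<in> ?W" by (auto simp: pull_def)
      then obtain k v where kv: "k \<in> K" "v \<in> Y" "z \<otimes> f = z \<otimes> k \<oplus> v" by (blast elim: combE)
      have cl: "k \<in> carrier R" "v \<in> carrier R" using kv K ideal_carrier ideal_Y by blast+
      have "z \<otimes> (f \<ominus> k) = z \<otimes> f \<ominus> z \<otimes> k" using cl f z by algebra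
      also have "\<dots> = v" unfolding kv using cl z by algebra
      finally have "f \<ominus> k \<in> Y" using z_cancel[of "f \<ominus> k"] kv cl f by simp
      then have "k \<oplus> (f \<ominus> k) \<in> K" using assms kv by (auto intro: ideal_add)
      moreover have "k \<oplus> (f \<ominus> k) = f" using cl f by algebra
      ultimately show "f \<in> K" by simp
    qed
    show "K \<subseteq> pull R z (carrier R) ?W"
      using K ideal_subset[OF K] by (auto simp: pull_def intro: comb_mult_mem)
  qed
  have "qlength R n ?W = qlength R (carrier R) K"
    using qlength_comb[OF oneideal W z] n pull by simp
  moreover have "qlength R (carrier R) ?W = 1 + qlength R n ?W"
    using qlength_add[OF W ideal_n oneideal Wn] ideal_subset ideal_n
    by (simp add: qlength_maximal[OF max_n])
  moreover have "qlength R (carrier R) ?W = qlength R (carrier R) K + qlength R K ?W"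
    using qlength_add[OF W K oneideal WK] ideal_subset K by simp
  ultimately show ?thesis
    using fin by (metis add.commute enat_add_left_cancel)
qed

text \<open>Since z is cancellable modulo Y, multiplication by z^k identifies K / (zK + Y) with the
  layer (z^k K + Y) / (z^(k+1) K + Y), so each layer has length one.\<close>

lemma qlength_zpowK:
  assumes K: "ideal K R" and "Y \<subseteq> K" and fin: "qlength R (carrier R) K \<noteq> \<infinity>"
  shows "qlength R K (comb R (z [^] (k::nat)) K Y) = enat k"
proof (induction k)
  case 0
  have "comb R \<one> K Y = K"
  proof
    show "comb R \<one> K Y \<subseteq> K" using assms ideal_carrier[OF K] by (intro comb_least) auto
    show "K \<subseteq> comb R \<one> K Y" using K by (simp add: sum_ideal_supset_left)
  qed
  then show ?case by (simp add: zero_enat_def)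
next
  case (Suc k)
  let ?w = "z [^] k" and ?W = "\<lambda>k. comb R (z [^] (k::nat)) K Y"
  have W: "ideal (?W k) R" for k using K by (simp add: comb_ideal)
  have YW: "Y \<subseteq> ?W k" for k using K by (simp add: comb_supset_right)
  have zK: "z \<otimes> f \<in> K" if "f \<in> K" for f using that K by (simp add: ideal_lmult)
  have step: "?W (Suc k) \<subseteq> ?W k"
  proof (rule comb_least)
    fix f assume f: "f \<in> K"
    have "z [^] Suc k \<otimes> f = ?w \<otimes> (z \<otimes> f)" using f ideal_carrier[OF K] by (simp add: m_assoc)
    then show "z [^] Suc k \<otimes> f \<in> ?W k" using K zK[OF f] by (simp add: comb_mult_mem)
  qed (use W YW in auto)
  have eq: "?W k = comb R ?w K (?W (Suc k))"
  proof
    show "?W k \<subseteq> comb R ?w K (?W (Suc k))" by (intro comb_mono order_refl YW)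
    show "comb R ?w K (?W (Suc k)) \<subseteq> ?W k"
      by (rule comb_least[OF W step]) (use K in \<open>simp add: comb_mult_mem\<close>)
  qed
  have pull: "pull R ?w K (?W (Suc k)) = comb R z K Y"
  proof
    show "pull R ?w K (?W (Suc k)) \<subseteq> comb R z K Y"
    proof
      fix f assume "f \<in> pull R ?w K (?W (Suc k))"
      then have f: "f \<in> K" "?w \<otimes> f \<in> ?W (Suc k)" by (auto simp: pull_def)
      then obtain k' v where kv: "k' \<in> K" "v \<in> Y" "?w \<otimes> f = z [^] Suc k \<otimes> k' \<oplus> v" by (blast elim: combE)
      have cl: "k' \<in> carrier R" "v \<in> carrier R" "f \<in> carrier R" "?w \<in> carrier R"
        using f kv K ideal_carrier ideal_Y z by blast+
      have "?w \<otimes> (f \<ominus> z \<otimes> k') = ?w \<otimes> f \<ominus> (?w \<otimes> z) \<otimes> k'" using cl z by algebra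
      also have "\<dots> = v" unfolding kv nat_pow_Suc using cl z by algebra
      finally have "f \<ominus> z \<otimes> k' \<in> Y" using zpow_cancel[of "f \<ominus> z \<otimes> k'" k] kv cl by simp
      then have "z \<otimes> k' \<oplus> (f \<ominus> z \<otimes> k') \<in> comb R z K Y" using kv by (intro combI)
      moreover have "z \<otimes> k' \<oplus> (f \<ominus> z \<otimes> k') = f" using cl z by algebra
      ultimately show "f \<in> comb R z K Y" by simp
    qed
    show "comb R z K Y \<subseteq> pull R ?w K (?W (Suc k))"
    proof (rule comb_least)
      show "ideal (pull R ?w K (?W (Suc k))) R" using K W[of "Suc k"] by (simp add: pull_ideal)
      show "Y \<subseteq> pull R ?w K (?W (Suc k))"
        using assms(2) subsetD[OF YW[of "Suc k"]] ideal_lmult[OF ideal_Y, of _ ?w] by (auto simp: pull_def)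
      fix f assume f: "f \<in> K"
      have "?w \<otimes> (z \<otimes> f) = z [^] Suc k \<otimes> f" using f ideal_carrier[OF K] by (simp add: m_assoc)
      then show "z \<otimes> f \<in> pull R ?w K (?W (Suc k))"
        using f zK K by (simp add: pull_def comb_mult_mem del: nat_pow_Suc)
    qed
  qed
  have "qlength R (?W k) (?W (Suc k)) = 1"
    using qlength_comb[OF K W[of "Suc k"], of ?w] eq pull qlength_zK[OF assms] by simp
  moreover have "?W k \<subseteq> K"
    using assms by (intro comb_least) (auto intro: ideal_lmult)
  ultimately have "qlength R K (?W (Suc k)) = enat k + 1"
    using qlength_add[OF W W K step] Suc by simp
  then show ?case by (simp add: one_enat_def)
qed

end

text \<open>The definitions encode the module \<open>N = I / (yI + X)\<close> over the discrete valuation ring \<open>R / Y\<close>,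
  its torsion part \<open>M\<close>, which \<open>y\<close> identifies with \<open>colon_y / I\<close>, and the free
  quotient \<open>N / M\<close> of rank one: \<open>pw i\<close> represents \<open>z\<^sup>iN\<close>, \<open>pwM i\<close> represents \<open>z\<^sup>iM\<close>, and
  \<open>yc\<close> is the preimage of \<open>M\<close> in \<open>I\<close>.\<close>

locale two_params_ideal = two_params +
  fixes I
  assumes ideal_I [simp]: "ideal I R" and X_I: "X \<subseteq> I"
begin

definition "colon_y = pull R y (carrier R) I"
definition "pw i = comb R (z [^] (i::nat)) I (comb R y I X)"
definition "yc = comb R y colon_y X"
definition "pwM i = comb R (z [^] (i::nat)) colon_y I"

lemma I_carrier: "f \<in> I \<Longrightarrow> f \<in> carrier R"
  by (rule ideal_carrier[OF ideal_I])

lemma colon_carrier: "f \<in> colon_y \<Longrightarrow> f \<in> carrier R"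
  by (simp add: colon_y_def pull_def)

lemma ideal_colon [simp]: "ideal colon_y R"
  unfolding colon_y_def by (simp add: pull_ideal oneideal)

lemma I_colon: "I \<subseteq> colon_y"
  unfolding colon_y_def by (auto simp: pull_def ideal_lmult dest: I_carrier)

lemma X_colon: "X \<subseteq> colon_y"
  using X_I I_colon by blast

lemma y_colon: "f \<in> colon_y \<Longrightarrow> y \<otimes> f \<in> I"
  by (simp add: colon_y_def pull_def)

lemma ideal_yI [simp]: "ideal (comb R y I X) R"
  by (simp add: comb_ideal)

lemma ideal_pw [simp]: "ideal (pw i) R"
  unfolding pw_def by (simp add: comb_ideal)

lemma ideal_yc [simp]: "ideal yc R"
  unfolding yc_def by (simp add: comb_ideal)

lemma ideal_pwM [simp]: "ideal (pwM i) R"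
  unfolding pwM_def by (simp add: comb_ideal)

lemma yI_pw: "f \<in> I \<Longrightarrow> y \<otimes> f \<in> pw i"
  unfolding pw_def using comb_supset_right[of I "comb R y I X" "z [^] i"] comb_mult_mem[of I X y f] by auto

lemma X_pw: "X \<subseteq> pw i"
  unfolding pw_def using comb_supset_right[of I "comb R y I X" "z [^] i"] comb_supset_right[of I X y] by auto

lemma zI_pw: "f \<in> I \<Longrightarrow> z [^] i \<otimes> f \<in> pw i"
  unfolding pw_def by (simp add: comb_mult_mem)

lemma pw_least:
  assumes "ideal L R" "X \<subseteq> L" "\<And>f. f \<in> I \<Longrightarrow> y \<otimes> f \<in> L" "\<And>f. f \<in> I \<Longrightarrow> z [^] i \<otimes> f \<in> L"
  shows "pw i \<subseteq> L"
  unfolding pw_def using assms by (intro comb_least) auto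

lemma pw_0: "pw 0 = I"
proof
  show "pw 0 \<subseteq> I" using X_I I_carrier by (intro pw_least) (auto intro: ideal_lmult)
  show "I \<subseteq> pw 0" using zI_pw[of _ 0] I_carrier by fastforce
qed

lemma pw_Suc_le: "pw (Suc i) \<subseteq> pw i"
proof (rule pw_least)
  fix f assume f: "f \<in> I"
  have "z [^] Suc i \<otimes> f = z [^] i \<otimes> (z \<otimes> f)" using I_carrier[OF f] by (simp add: m_assoc)
  then show "z [^] Suc i \<otimes> f \<in> pw i" using zI_pw[of "z \<otimes> f" i] f by (simp add: ideal_lmult)
qed (auto simp: X_pw[THEN subsetD] yI_pw)

lemma pw_le_I: "pw i \<subseteq> I"
  by (induction i) (use pw_0 pw_Suc_le in auto)

lemma yc_I: "yc \<subseteq> I"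
  unfolding yc_def using X_I y_colon by (intro comb_least) auto

lemma y_yc: "f \<in> colon_y \<Longrightarrow> y \<otimes> f \<in> yc"
  unfolding yc_def by (simp add: comb_mult_mem)

lemma X_yc: "X \<subseteq> yc"
  unfolding yc_def by (simp add: comb_supset_right)

lemma yc_eq: "yc = I \<inter> Y"
proof
  show "yc \<subseteq> I \<inter> Y"
  proof -
    have "yc \<subseteq> Y"
      unfolding yc_def using X_Y y_in_Y colon_carrier by (intro comb_least) auto
    then show ?thesis using yc_I by blast
  qed
  show "I \<inter> Y \<subseteq> yc"
  proof
    fix f assume f: "f \<in> I \<inter> Y"
    then obtain k x where kx: "k \<in> carrier R" "x \<in> X" "f = y \<otimes> k \<oplus> x"
      unfolding Y_eq by (blast elim: combE)
    have cl: "x \<in> carrier R" using kx ideal_carrier[OF ideal_X] by blast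
    have "y \<otimes> k \<in> I"
      using ideal_add_cancel[of I x "y \<otimes> k"] kx cl X_I f by (auto simp: a_comm)
    then have "k \<in> colon_y" using kx by (simp add: colon_y_def pull_def)
    then show "f \<in> yc" unfolding yc_def kx(3) using kx by (intro combI)
  qed
qed

text \<open>The preimage in I of z^i times the free quotient I / yc of N.\<close>

definition "pwyc i = comb R (z [^] (i::nat)) I yc"

lemma ideal_pwyc [simp]: "ideal (pwyc i) R"
  unfolding pwyc_def by (simp add: comb_ideal)

lemma pwyc_I: "pwyc i \<subseteq> I"
  unfolding pwyc_def using yc_I by (intro comb_least) (auto intro: ideal_lmult)

text \<open>I / yc is (I + Y) / Y by the second isomorphism theorem, an ideal of the discrete
  valuation ring, so every factor z costs length one. Finite colength excludes I \<subseteq> Y,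
  where this quotient would vanish.\<close>

lemma qlength_pwyc:
  assumes fin: "qlength R (carrier R) I \<noteq> \<infinity>"
  shows "qlength R I (pwyc k) = enat k"
proof -
  let ?K = "comb R \<one> I Y"
  let ?W = "comb R (z [^] k) ?K Y"
  have K: "ideal ?K R" by (simp add: comb_ideal)
  have IK: "I \<subseteq> ?K" by (simp add: sum_ideal_supset_left)
  have YK: "Y \<subseteq> ?K" by (simp add: comb_supset_right)
  have W: "ideal ?W R" using K by (simp add: comb_ideal)
  have YW: "Y \<subseteq> ?W" using K by (simp add: comb_supset_right)
  have WK: "?W \<subseteq> ?K" using K YK by (intro comb_least) (auto intro: ideal_lmult)
  have "qlength R (carrier R) ?K \<le> qlength R (carrier R) I"
    using K IK ideal_subset[OF K] oneideal by (intro qlength_antimono) auto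
  then have finK: "qlength R (carrier R) ?K \<noteq> \<infinity>"
    using fin by (cases "qlength R (carrier R) ?K") auto
  have KW: "?K = comb R \<one> I ?W"
  proof
    show "?K \<subseteq> comb R \<one> I ?W" using YW by (intro comb_mono) auto
    show "comb R \<one> I ?W \<subseteq> ?K" by (rule comb_least[OF K WK]) (use IK I_carrier in auto)
  qed
  have "I \<inter> ?W = pwyc k"
  proof
    show "I \<inter> ?W \<subseteq> pwyc k"
    proof
      fix f assume f: "f \<in> I \<inter> ?W"
      then obtain g v where gv: "g \<in> ?K" "v \<in> Y" "f = z [^] k \<otimes> g \<oplus> v" by (blast elim: combE)
      obtain a v' where av: "a \<in> I" "v' \<in> Y" "g = \<one> \<otimes> a \<oplus> v'" using gv(1) by (rule combE)
      have cl: "a \<in> carrier R" "v \<in> carrier R" "v' \<in> carrier R" "f \<in> carrier R" "z [^] k \<in> carrier R"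
        using av gv f I_carrier ideal_carrier[OF ideal_Y] by auto
      define u where "u = z [^] k \<otimes> v' \<oplus> v"
      have u: "u \<in> Y" unfolding u_def using av gv by (auto intro!: ideal_add ideal_lmult)
      have eq: "f = z [^] k \<otimes> a \<oplus> u"
        unfolding gv(3) av(3) u_def using cl by algebra
      have "u \<in> I"
        using ideal_add_cancel[OF ideal_I, of "z [^] k \<otimes> a" u] eq f av(1) u
          ideal_carrier[OF ideal_Y] ideal_lmult[OF ideal_I av(1)] by simp
      then show "f \<in> pwyc k"
        unfolding pwyc_def eq using u av by (intro combI) (auto simp: yc_eq)
    qed
    show "pwyc k \<subseteq> I \<inter> ?W"
    proof -
      have "pwyc k \<subseteq> ?W"
        unfolding pwyc_def yc_eq using W YW K IK by (intro comb_least) (auto intro: comb_mult_mem)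
      then show ?thesis using pwyc_I by blast
    qed
  qed
  then have "qlength R ?K ?W = qlength R I (pwyc k)"
    using qlength_comb[OF ideal_I W one_closed] KW by (simp add: pull_one)
  then show ?thesis using qlength_zpowK[OF K YK finK] by simp
qed

lemma z_pw: "f \<in> pw i \<Longrightarrow> z \<otimes> f \<in> pw (Suc i)"
proof -
  assume "f \<in> pw i"
  moreover have "pw i \<subseteq> pull R z (pw i) (pw (Suc i))"
  proof (rule pw_least)
    show "ideal (pull R z (pw i) (pw (Suc i))) R" by (simp add: pull_ideal)
    show "X \<subseteq> pull R z (pw i) (pw (Suc i))"
      using X_pw[of i] X_pw[of "Suc i"] by (auto simp: pull_def intro!: ideal_lmult)
    show "y \<otimes> f \<in> pull R z (pw i) (pw (Suc i))" if "f \<in> I" for f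
      using that yI_pw[of f i] yI_pw[of f "Suc i"] by (auto simp: pull_def intro!: ideal_lmult)
    show "z [^] i \<otimes> f \<in> pull R z (pw i) (pw (Suc i))" if f: "f \<in> I" for f
    proof -
      have "z \<otimes> (z [^] i \<otimes> f) = z [^] Suc i \<otimes> f" using I_carrier[OF f] by (simp add: m_ac)
      then show ?thesis using f zI_pw[OF f, of i] zI_pw[OF f, of "Suc i"] by (simp add: pull_def)
    qed
  qed
  ultimately show "z \<otimes> f \<in> pw (Suc i)" by (auto simp: pull_def)
qed

text \<open>Multiplication by z maps z^i N / z^(i+1) N onto the next layer, so
  \<open>\<mu>\<^sub>i\<close> can only decrease with i.\<close>

lemma qlength_pw_Suc:
  "qlength R (pw (Suc i)) (pw (Suc (Suc i))) \<le> qlength R (pw i) (pw (Suc i))"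
proof -
  have eq: "pw (Suc i) = comb R z (pw i) (pw (Suc (Suc i)))"
  proof
    show "comb R z (pw i) (pw (Suc (Suc i))) \<subseteq> pw (Suc i)"
      using pw_Suc_le z_pw by (intro comb_least) auto
    show "pw (Suc i) \<subseteq> comb R z (pw i) (pw (Suc (Suc i)))"
    proof (rule pw_least)
      show "ideal (comb R z (pw i) (pw (Suc (Suc i)))) R" by (simp add: comb_ideal)
      have sub: "pw (Suc (Suc i)) \<subseteq> comb R z (pw i) (pw (Suc (Suc i)))"
        by (simp add: comb_supset_right)
      then show "X \<subseteq> comb R z (pw i) (pw (Suc (Suc i)))" using X_pw by blast
      show "y \<otimes> f \<in> comb R z (pw i) (pw (Suc (Suc i)))" if "f \<in> I" for f
        using sub yI_pw[OF that] by blast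
      show "z [^] Suc i \<otimes> f \<in> comb R z (pw i) (pw (Suc (Suc i)))" if f: "f \<in> I" for f
      proof -
        have "z [^] Suc i \<otimes> f = z \<otimes> (z [^] i \<otimes> f)" using I_carrier[OF f] by (simp add: m_ac)
        then show ?thesis using zI_pw[OF f, of i] by (simp add: comb_mult_mem)
      qed
    qed
  qed
  have "pw (Suc i) \<subseteq> pull R z (pw i) (pw (Suc (Suc i)))"
    using pw_Suc_le z_pw by (auto simp: pull_def)
  then have "qlength R (comb R z (pw i) (pw (Suc (Suc i)))) (pw (Suc (Suc i)))
      \<le> qlength R (pw i) (pw (Suc i))"
    by (intro qlength_comb_le) auto
  then show ?thesis by (simp only: eq[symmetric])
qed

text \<open>The quotient N / z^k N has k layers, all of index at most i, and each is at least as
  large as the i-th.\<close>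

lemma qlength_pw_ge:
  "k \<le> Suc i \<Longrightarrow> enat k * qlength R (pw i) (pw (Suc i)) \<le> qlength R I (pw k)"
proof (induction k)
  case (Suc k)
  have anti: "qlength R (pw i) (pw (Suc i)) \<le> qlength R (pw k) (pw (Suc k))" if "k \<le> i" for k
    using that by (induction i rule: dec_induct) (use qlength_pw_Suc order_trans in blast)+
  have "enat (Suc k) * qlength R (pw i) (pw (Suc i))
      = enat k * qlength R (pw i) (pw (Suc i)) + qlength R (pw i) (pw (Suc i))"
    by (simp add: eSuc_enat[symmetric] eSuc_plus_1 distrib_right)
  also have "\<dots> \<le> qlength R I (pw k) + qlength R (pw k) (pw (Suc k))"
    using Suc anti by (intro add_mono) auto
  also have "\<dots> = qlength R I (pw (Suc k))"
    using qlength_add[of "pw (Suc k)" "pw k" I] pw_Suc_le pw_le_I by simp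
  finally show ?case .
qed (simp add: zero_enat_def[symmetric])

text \<open>In N / z^k N the free quotient contributes exactly k, and the image of M at most its own
  length, that of (I : y) / I.\<close>

lemma qlength_pw_le:
  assumes fin: "qlength R (carrier R) I \<noteq> \<infinity>"
  shows "qlength R I (pw k) \<le> qlength R colon_y I + enat k"
proof -
  have "pwyc k = comb R y colon_y (pw k)"
  proof
    have sub: "pw k \<subseteq> comb R y colon_y (pw k)" by (simp add: comb_supset_right)
    have id: "ideal (comb R y colon_y (pw k)) R" by (simp add: comb_ideal)
    have "yc \<subseteq> comb R y colon_y (pw k)" unfolding yc_def using X_pw by (intro comb_mono) auto
    then show "pwyc k \<subseteq> comb R y colon_y (pw k)"
      unfolding pwyc_def using id sub zI_pw by (intro comb_least) auto
    have right: "yc \<subseteq> pwyc k" unfolding pwyc_def by (simp add: comb_supset_right)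
    show "comb R y colon_y (pw k) \<subseteq> pwyc k"
    proof (rule comb_least)
      show "pw k \<subseteq> pwyc k"
      proof (rule pw_least)
        show "X \<subseteq> pwyc k" using right X_yc by blast
        show "y \<otimes> f \<in> pwyc k" if "f \<in> I" for f using right y_yc that I_colon by blast
        show "z [^] k \<otimes> f \<in> pwyc k" if "f \<in> I" for f
          unfolding pwyc_def using that by (simp add: comb_mult_mem)
      qed simp
    qed (use right y_yc in auto)
  qed
  moreover have "I \<subseteq> pull R y colon_y (pw k)"
    using I_colon yI_pw by (auto simp: pull_def)
  ultimately have le: "qlength R (pwyc k) (pw k) \<le> qlength R colon_y I"
    using qlength_comb_le[of colon_y "pw k" y I] by simp
  have "pw k \<subseteq> pwyc k"
    using \<open>pwyc k = _\<close> comb_supset_right[of colon_y "pw k" y] by simp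
  then have "qlength R I (pw k) = enat k + qlength R (pwyc k) (pw k)"
    using qlength_add[of "pw k" "pwyc k" I] pwyc_I qlength_pwyc[OF fin] by simp
  then show ?thesis using le by (metis add.commute add_left_mono)
qed

text \<open>Both estimates of N / z^k N are compared at k = i + 1, the largest k for which every
  layer is known to dominate the i-th. The summand on the right stands in for a subtraction on the
  left.\<close>

lemma colon_length_ge:
  assumes fin: "qlength R (carrier R) I \<noteq> \<infinity>"
  shows "enat (Suc i) * qlength R (pw i) (pw (Suc i)) \<le> qlength R colon_y I + enat (Suc i)"
  using qlength_pw_ge[of "Suc i" i] qlength_pw_le[OF fin] order_trans by blast

lemma ideal_colon_locale: "two_params_ideal R X Y n y z colon_y"
  by (intro two_params_ideal.intro two_params_ideal_axioms.intro two_params_axioms ideal_colon X_colon)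

text \<open>One generator suffices for the free quotient of z^i N. What remains is the image of z^i
  M; multiplication by y reaches it from the module belonging to I : y, so the generators counted
  there suffice for it.\<close>

lemma colon_length_le:
  assumes fin: "qlength R (carrier R) I \<noteq> \<infinity>"
  shows "qlength R (pw i) (pw (Suc i))
    \<le> 1 + qlength R (two_params_ideal.pw R X y z colon_y i) (two_params_ideal.pw R X y z colon_y (Suc i))"
proof -
  interpret C: two_params_ideal R X Y n y z colon_y by (rule ideal_colon_locale)
  let ?P = "comb R y (C.pw i) (pw (Suc i))"
  have P: "ideal ?P R" by (simp add: comb_ideal)
  have right: "pw (Suc i) \<subseteq> ?P" by (simp add: comb_supset_right)
  have yP: "y \<otimes> f \<in> ?P" if "f \<in> C.pw i" for f using that by (simp add: comb_mult_mem)
  have zC: "y \<otimes> (z [^] j \<otimes> f) \<in> pw j" if f: "f \<in> colon_y" for f and j :: nat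
  proof -
    have "y \<otimes> (z [^] j \<otimes> f) = z [^] j \<otimes> (y \<otimes> f)" using colon_carrier[OF f] by (simp add: m_ac)
    then show ?thesis using zI_pw y_colon[OF f] by simp
  qed
  have sub1: "C.pw j \<subseteq> pull R y (C.pw j) (pw j)" for j
  proof (rule C.pw_least)
    show "ideal (pull R y (C.pw j) (pw j)) R" by (simp add: pull_ideal)
    show "X \<subseteq> pull R y (C.pw j) (pw j)"
      using X_pw C.X_pw by (auto simp: pull_def intro!: ideal_lmult)
    show "y \<otimes> f \<in> pull R y (C.pw j) (pw j)" if "f \<in> colon_y" for f
      using C.yI_pw[OF that] y_colon[OF that] yI_pw by (auto simp: pull_def)
    show "z [^] j \<otimes> f \<in> pull R y (C.pw j) (pw j)" if "f \<in> colon_y" for f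
      using C.zI_pw[OF that] zC[OF that] by (auto simp: pull_def)
  qed
  have Ppw: "?P \<subseteq> pw i"
    using pw_Suc_le[of i] sub1[of i] by (intro comb_least[where K = "C.pw i"]) (auto simp: pull_def)
  have "pw i = comb R (z [^] i) I ?P"
  proof
    show "comb R (z [^] i) I ?P \<subseteq> pw i"
      using Ppw zI_pw by (intro comb_least[where K = I]) auto
    have "?P \<subseteq> comb R (z [^] i) I ?P" using P by (simp add: comb_supset_right)
    then show "pw i \<subseteq> comb R (z [^] i) I ?P"
      using P right yI_pw X_pw[of "Suc i"]
      by (intro pw_least) (auto simp: comb_ideal comb_mult_mem)
  qed
  moreover have "pwyc 1 \<subseteq> pull R (z [^] i) I ?P"
    unfolding pwyc_def
  proof (rule comb_least)
    show id: "ideal (pull R (z [^] i) I ?P) R" using P by (simp add: pull_ideal)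
    show "yc \<subseteq> pull R (z [^] i) I ?P"
      unfolding yc_def
    proof (rule comb_least)
      show "X \<subseteq> pull R (z [^] i) I ?P"
        using X_I X_pw right P by (auto simp: pull_def intro!: ideal_lmult)
      fix f assume f: "f \<in> colon_y"
      have "z [^] i \<otimes> (y \<otimes> f) = y \<otimes> (z [^] i \<otimes> f)" using colon_carrier[OF f] by (simp add: m_ac)
      then show "y \<otimes> f \<in> pull R (z [^] i) I ?P"
        using y_colon[OF f] yP[OF C.zI_pw[OF f]] by (simp add: pull_def)
    qed (rule id)
    fix f assume f: "f \<in> I"
    have "z [^] i \<otimes> (z [^] (1::nat) \<otimes> f) = z [^] Suc i \<otimes> f"
      using I_carrier[OF f] by (simp add: m_assoc)
    then show "z [^] (1::nat) \<otimes> f \<in> pull R (z [^] i) I ?P"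
      using right zI_pw[OF f, of "Suc i"] f ideal_lmult[OF ideal_I f]
      by (auto simp: pull_def)
  qed
  ultimately have "qlength R (pw i) ?P \<le> qlength R I (pwyc 1)"
    using qlength_comb_le[of I ?P "z [^] i" "pwyc 1"] P by simp
  then have top: "qlength R (pw i) ?P \<le> 1"
    using qlength_pwyc[OF fin] by (simp add: one_enat_def)
  have "C.pw (Suc i) \<subseteq> pull R y (C.pw i) (pw (Suc i))"
    using sub1[of "Suc i"] C.pw_Suc_le by (auto simp: pull_def)
  then have "qlength R ?P (pw (Suc i)) \<le> qlength R (C.pw i) (C.pw (Suc i))"
    by (intro qlength_comb_le) auto
  moreover have "qlength R (pw i) (pw (Suc i)) = qlength R (pw i) ?P + qlength R ?P (pw (Suc i))"
    using P right Ppw by (intro qlength_add) auto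
  ultimately show ?thesis using top by (simp add: add_mono)
qed


section \<open>Generators bounded below by the socle\<close>

lemma ideal_socle [simp]: "ideal (pull R z colon_y I) R"
  by (simp add: pull_ideal)

lemma I_socle: "I \<subseteq> pull R z colon_y I"
  using I_colon by (auto simp: pull_def ideal_lmult)

lemma I_pwM: "I \<subseteq> pwM i"
  unfolding pwM_def by (simp add: comb_supset_right)

lemma zpwM: "f \<in> colon_y \<Longrightarrow> z [^] i \<otimes> f \<in> pwM i"
  unfolding pwM_def by (simp add: comb_mult_mem)

lemma pwM_Suc_le: "pwM (Suc i) \<subseteq> pwM i"
  unfolding pwM_def[of "Suc i"]
proof (rule comb_least)
  fix f assume f: "f \<in> colon_y"
  have "z [^] Suc i \<otimes> f = z [^] i \<otimes> (z \<otimes> f)" using colon_carrier[OF f] by (simp add: m_assoc)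
  then show "z [^] Suc i \<otimes> f \<in> pwM i" using zpwM[of "z \<otimes> f" i] f by (simp add: ideal_lmult)
qed (use I_pwM in auto)

lemma pwM_colon: "pwM i \<subseteq> colon_y"
  unfolding pwM_def using I_colon by (intro comb_least) (auto intro: ideal_lmult)

lemma z_pwM: "f \<in> pwM i \<Longrightarrow> z \<otimes> f \<in> pwM (Suc i)"
proof -
  assume "f \<in> pwM i"
  then obtain a b where ab: "a \<in> colon_y" "b \<in> I" "f = z [^] i \<otimes> a \<oplus> b"
    unfolding pwM_def by (rule combE)
  have "z \<otimes> f = z [^] Suc i \<otimes> a \<oplus> z \<otimes> b"
    using ab colon_carrier[OF ab(1)] I_carrier[OF ab(2)] by (simp add: r_distr m_ac)
  then show "z \<otimes> f \<in> pwM (Suc i)"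
    unfolding pwM_def using ab combI[of a colon_y "z \<otimes> b" I R "z [^] Suc i"] by (simp add: ideal_lmult)
qed

text \<open>Because N / M is torsion-free, an element of M that lies in z^(i+1) N lies in z^(i+1) M.
  As y identifies (I : y) / I with M, the intersection appears as a preimage under y.\<close>

lemma pull_y_pwM: "pull R y (pwM i) (pw (Suc i)) = pwM (Suc i)"
proof
  show "pull R y (pwM i) (pw (Suc i)) \<subseteq> pwM (Suc i)"
  proof
    fix f assume f: "f \<in> pull R y (pwM i) (pw (Suc i))"
    let ?w = "z [^] Suc i"
    obtain a u where au: "a \<in> I" "u \<in> comb R y I X" "y \<otimes> f = ?w \<otimes> a \<oplus> u"
      using f unfolding pull_def pw_def by (blast elim: combE)
    obtain b x where bx: "b \<in> I" "x \<in> X" "u = y \<otimes> b \<oplus> x"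
      using au(2) by (rule combE)
    have cl: "f \<in> carrier R" "a \<in> carrier R" "b \<in> carrier R" "x \<in> carrier R" "?w \<in> carrier R"
      using f au bx I_carrier ideal_carrier[OF ideal_X] ideal_carrier[OF ideal_pwM]
      by (auto simp: pull_def)
    \<comment> \<open>Modulo Y only z^(i+1) a survives, so a lies in I \<inter> Y = yc and can be
      traded for y times an element of I : y.\<close>
    have "?w \<otimes> a = y \<otimes> f \<ominus> (y \<otimes> b \<oplus> x)"
      unfolding au(3) bx(3) using cl y by algebra
    also have "\<dots> = y \<otimes> (f \<ominus> b) \<ominus> x" using cl y by algebra
    also have "\<dots> \<in> Y" using y_in_Y X_Y cl bx by (auto intro!: ideal_minus)
    finally have "a \<in> yc" using zpow_cancel[of a "Suc i"] cl au yc_eq by blast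
    then obtain a' x' where ax: "a' \<in> colon_y" "x' \<in> X" "a = y \<otimes> a' \<oplus> x'"
      unfolding yc_def by (rule combE)
    have cl': "a' \<in> carrier R" "x' \<in> carrier R"
      using ax colon_carrier ideal_carrier[OF ideal_X] by auto
    define g where "g = f \<ominus> b \<ominus> ?w \<otimes> a'"
    have g: "g \<in> carrier R" unfolding g_def using cl cl' by simp
    have "y \<otimes> g = y \<otimes> f \<ominus> y \<otimes> b \<ominus> ?w \<otimes> (y \<otimes> a')"
      unfolding g_def using cl cl' y by algebra
    also have "\<dots> = x \<oplus> ?w \<otimes> x'"
      unfolding au(3) bx(3) ax(3) using cl cl' y by algebra
    also have "\<dots> \<in> X" using bx(2) ideal_lmult[OF ideal_X ax(2) cl(5)] by (intro ideal_add) simp_all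
    finally have "g \<in> I" using y_cancel[OF g] X_I by blast
    then have "?w \<otimes> a' \<oplus> (b \<oplus> g) \<in> pwM (Suc i)"
      unfolding pwM_def using ax bx by (intro combI) (auto intro: ideal_add)
    moreover have "?w \<otimes> a' \<oplus> (b \<oplus> g) = f"
      unfolding g_def using cl cl' by algebra
    ultimately show "f \<in> pwM (Suc i)" by simp
  qed
  show "pwM (Suc i) \<subseteq> pull R y (pwM i) (pw (Suc i))"
  proof -
    have "pwM (Suc i) \<subseteq> pull R y colon_y (pw (Suc i))"
      unfolding pwM_def
    proof (rule comb_least)
      show "I \<subseteq> pull R y colon_y (pw (Suc i))"
        using I_colon yI_pw by (auto simp: pull_def)
      fix f assume f: "f \<in> colon_y"
      have "y \<otimes> (z [^] Suc i \<otimes> f) = z [^] Suc i \<otimes> (y \<otimes> f)"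
        using colon_carrier[OF f] y z nat_pow_closed[OF z] m_lcomm by blast
      then show "z [^] Suc i \<otimes> f \<in> pull R y colon_y (pw (Suc i))"
        unfolding pull_def using zI_pw[OF y_colon[OF f], of "Suc i"] f
          ideal_lmult[OF ideal_colon f, of "z [^] Suc i"] by simp
    qed (simp add: pull_ideal)
    then show ?thesis using pwM_Suc_le by (auto simp: pull_def)
  qed
qed

text \<open>On the finite-length module z^i M the kernel and the cokernel of z have equal length.
  The kernel is the part of J / I inside z^i M, and the inclusion \<open>socle\<close> makes it all
  of J / I.\<close>

lemma qlength_socle_le:
  assumes fin: "qlength R (carrier R) I \<noteq> \<infinity>"
    and socle: "pull R z colon_y I \<subseteq> pwM i"
  shows "qlength R (pull R z colon_y I) I \<le> qlength R (pwM i) (pwM (Suc i))"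
proof -
  let ?J = "pull R z colon_y I"
  have eq: "pwM (Suc i) = comb R z (pwM i) I"
  proof
    show "comb R z (pwM i) I \<subseteq> pwM (Suc i)" using I_pwM z_pwM by (intro comb_least) auto
    show "pwM (Suc i) \<subseteq> comb R z (pwM i) I"
      unfolding pwM_def[of "Suc i"]
    proof (rule comb_least)
      fix f assume f: "f \<in> colon_y"
      have "z [^] Suc i \<otimes> f = z \<otimes> (z [^] i \<otimes> f)" using colon_carrier[OF f] by (simp add: m_ac)
      then show "z [^] Suc i \<otimes> f \<in> comb R z (pwM i) I" using zpwM[OF f] by (simp add: comb_mult_mem)
    qed (simp_all add: comb_ideal comb_supset_right)
  qed
  have "pull R z (pwM i) I = ?J"
    using socle pwM_colon by (auto simp: pull_def)
  then have "qlength R (pwM (Suc i)) I = qlength R (pwM i) ?J"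
    using qlength_comb[of "pwM i" I z] eq by simp
  moreover have "qlength R (pwM i) I = qlength R (pwM i) ?J + qlength R ?J I"
    using socle I_socle by (intro qlength_add) auto
  moreover have "qlength R (pwM i) I = qlength R (pwM i) (pwM (Suc i)) + qlength R (pwM (Suc i)) I"
    using pwM_Suc_le I_pwM by (intro qlength_add) auto
  moreover have "qlength R (pwM i) I \<noteq> \<infinity>"
  proof -
    have "qlength R (pwM i) I \<le> qlength R (carrier R) I"
      using I_pwM ideal_subset[OF ideal_pwM] oneideal by (intro qlength_mono) auto
    then show ?thesis using fin by (cases "qlength R (pwM i) I") auto
  qed
  ultimately show ?thesis
    by (cases "qlength R (pwM i) ?J"; cases "qlength R ?J I"; cases "qlength R (pwM i) (pwM (Suc i))") auto
qed

text \<open>The generator of the free quotient is indispensable, so it adds to those of z^i M, which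
  are at least as many as the socle has dimensions.\<close>

lemma socle_length_le:
  assumes fin: "qlength R (carrier R) I \<noteq> \<infinity>"
    and socle: "pull R z colon_y I \<subseteq> pwM i"
  shows "1 + qlength R (pull R z colon_y I) I \<le> qlength R (pw i) (pw (Suc i))"
proof -
  let ?P = "comb R y (pwM i) (pw (Suc i))"
  let ?w = "z [^] i" and ?w' = "z [^] Suc i"
  have P: "ideal ?P R" by (simp add: comb_ideal)
  have right: "pw (Suc i) \<subseteq> ?P" by (simp add: comb_supset_right)
  have yP: "y \<otimes> (?w \<otimes> f) \<in> pw i" if f: "f \<in> colon_y" for f
  proof -
    have "y \<otimes> (?w \<otimes> f) = ?w \<otimes> (y \<otimes> f)" using colon_carrier[OF f] by (simp add: m_ac)
    then show ?thesis using zI_pw y_colon[OF f] by simp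
  qed
  have "pwM i \<subseteq> pull R y colon_y (pw i)"
    unfolding pwM_def
    by (rule comb_least[OF pull_ideal]) (use I_colon yI_pw yP in \<open>auto simp: pull_def intro: ideal_lmult\<close>)
  then have Ppw: "?P \<subseteq> pw i"
    using pw_Suc_le[of i] by (intro comb_least[where K = "pwM i"]) (auto simp: pull_def)
  have eq: "pw i = comb R ?w I ?P"
  proof
    show "comb R ?w I ?P \<subseteq> pw i" using Ppw zI_pw by (intro comb_least[where K = I]) auto
    have "?P \<subseteq> comb R ?w I ?P" using P by (simp add: comb_supset_right)
    then show "pw i \<subseteq> comb R ?w I ?P"
      using P right yI_pw X_pw[of "Suc i"]
      by (intro pw_least) (auto simp: comb_ideal comb_mult_mem)
  qed
  \<comment> \<open>Cancelling z^i modulo Y: if z^i f falls into \<open>?P\<close>, then f lies in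
    zI + Y. Hence the free part of the layer survives modulo \<open>?P\<close>.\<close>
  have "pull R ?w I ?P \<subseteq> pwyc 1"
  proof
    fix f assume "f \<in> pull R ?w I ?P"
    then have f: "f \<in> I" "?w \<otimes> f \<in> ?P" by (auto simp: pull_def)
    have w': "ideal (comb R ?w' I Y) R" by (intro comb_ideal) auto
    have right': "Y \<subseteq> comb R ?w' I Y" by (rule comb_supset_right) auto
    have "pw (Suc i) \<subseteq> comb R ?w' I Y"
      by (rule pw_least[OF w']) (use right' X_Y y_in_Y I_carrier comb_mult_mem[OF ideal_I ideal_Y, of ?w'] in auto)
    then have "?P \<subseteq> comb R ?w' I Y"
      using w' right' y_in_Y ideal_carrier[OF ideal_pwM]
      by (intro comb_least[where K = "pwM i"]) auto
    then obtain c v where cv: "c \<in> I" "v \<in> Y" "?w \<otimes> f = ?w' \<otimes> c \<oplus> v"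
      using f by (blast elim: combE)
    have cl: "f \<in> carrier R" "c \<in> carrier R" "v \<in> carrier R" "?w \<in> carrier R"
      using f cv I_carrier ideal_carrier[OF ideal_Y] by auto
    have "?w \<otimes> (f \<ominus> z \<otimes> c) = ?w \<otimes> f \<ominus> (?w \<otimes> z) \<otimes> c" using cl z by algebra
    also have "\<dots> = v" unfolding cv nat_pow_Suc using cl z by algebra
    finally have "f \<ominus> z \<otimes> c \<in> Y" using zpow_cancel[of "f \<ominus> z \<otimes> c" i] cv cl by simp
    moreover have "f \<ominus> z \<otimes> c \<in> I" using f cv by (auto intro!: ideal_minus ideal_lmult)
    ultimately have "z [^] (1::nat) \<otimes> c \<oplus> (f \<ominus> z \<otimes> c) \<in> pwyc 1"
      unfolding pwyc_def yc_eq using cv by (intro combI) auto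
    moreover have "z [^] (1::nat) \<otimes> c \<oplus> (f \<ominus> z \<otimes> c) = f"
    proof -
      have "z \<otimes> c \<oplus> (f \<ominus> z \<otimes> c) = f" using cl z by algebra
      then show ?thesis using z by simp
    qed
    ultimately show "f \<in> pwyc 1" by simp
  qed
  then have "qlength R I (pwyc 1) \<le> qlength R I (pull R ?w I ?P)"
    using P pull_ideal[OF ideal_I P, of ?w] by (intro qlength_antimono) (auto simp: pull_def pwyc_I)
  then have top: "1 \<le> qlength R (pw i) ?P"
    using qlength_pwyc[OF fin, of 1] qlength_comb[of I ?P ?w] P eq by (simp add: one_enat_def)
  have "qlength R ?P (pw (Suc i)) = qlength R (pwM i) (pwM (Suc i))"
    using qlength_comb[of "pwM i" "pw (Suc i)" y] pull_y_pwM by simp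
  then have "qlength R (pull R z colon_y I) I \<le> qlength R ?P (pw (Suc i))"
    using qlength_socle_le[OF assms] by simp
  moreover have "qlength R (pw i) (pw (Suc i)) = qlength R (pw i) ?P + qlength R ?P (pw (Suc i))"
    using P right Ppw by (intro qlength_add) auto
  ultimately show ?thesis using top by (simp add: add_mono)
qed

end

section \<open>Summation over iterated colon ideals\<close>

context two_params
begin

text \<open>Along I, I : y, (I : y) : y, ... the colength drops by at least (i + 1)m, (i + 1)(m -
  1), ..., i + 1, a triangular sum. Doubling the right side avoids halving it.\<close>

lemma length_ge_triangle:
  assumes "ideal I R" "X \<subseteq> I" "qlength R (carrier R) I \<noteq> \<infinity>"
    and "enat (Suc m) \<le> qlength R (two_params_ideal.pw R X y z I i) (two_params_ideal.pw R X y z I (Suc i))"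
  shows "enat (Suc i * (m * Suc m)) \<le> 2 * qlength R (carrier R) I"
  using assms
proof (induction m arbitrary: I)
  case (Suc m)
  interpret two_params_ideal R X Y n y z I
    by (intro two_params_ideal.intro two_params_ideal_axioms.intro two_params_axioms Suc.prems)
  interpret C: two_params_ideal R X Y n y z colon_y by (rule ideal_colon_locale)
  note fin = Suc.prems(3)
  have sum: "qlength R (carrier R) I = qlength R (carrier R) colon_y + qlength R colon_y I"
    using I_colon ideal_subset[OF ideal_colon] oneideal by (intro qlength_add) auto
  then obtain a b where ab: "qlength R (carrier R) colon_y = enat a" "qlength R colon_y I = enat b"
    using fin by (cases "qlength R (carrier R) colon_y"; cases "qlength R colon_y I") auto
  have "enat (Suc (Suc m)) \<le> 1 + qlength R (C.pw i) (C.pw (Suc i))"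
    using Suc.prems(4) colon_length_le[OF fin, of i] by (rule order_trans)
  then have "enat (Suc m) \<le> qlength R (C.pw i) (C.pw (Suc i))"
    by (cases "qlength R (C.pw i) (C.pw (Suc i))") (auto simp: one_enat_def)
  then have IH: "enat (Suc i * (m * Suc m)) \<le> 2 * enat a"
    using Suc.IH[OF ideal_colon X_colon] ab by simp
  have "enat (Suc i) * enat (Suc (Suc m)) \<le> enat b + enat (Suc i)"
    unfolding ab(2)[symmetric]
    by (rule order_trans[OF mult_left_mono[OF Suc.prems(4)] colon_length_ge[OF fin]]) simp
  then have "Suc i * Suc (Suc m) \<le> b + Suc i"
    by (simp only: times_enat_simps plus_enat_simps enat_ord_simps)
  then have "Suc i * Suc m \<le> b" by simp
  moreover have "Suc i * (m * Suc m) \<le> 2 * a" using IH by (simp add: numeral_eq_enat)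
  ultimately have "Suc i * (Suc m * Suc (Suc m)) \<le> 2 * (a + b)" by (simp add: algebra_simps)
  then show ?case unfolding sum ab by (simp add: numeral_eq_enat)
qed (simp add: zero_enat_def[symmetric])

end

section \<open>Krull's principal ideal theorem\<close>

text \<open>The maximal condition for arbitrary nonempty families, obtained by choosing ever larger
  members. Both Nakayama arguments and the descending chain condition below rest on it.\<close>

lemma (in noetherian_ring) exists_maximal_ideal_in:
  assumes I0: "I0 \<in> S" and ideal: "\<And>I. I \<in> S \<Longrightarrow> ideal I R"
  obtains M where "M \<in> S" "\<And>J. J \<in> S \<Longrightarrow> M \<subseteq> J \<Longrightarrow> J = M"
proof (rule ccontr)
  assume "\<not> thesis"
  with that have no: "\<exists>J. J \<in> S \<and> I \<subset> J" if I: "I \<in> S" for I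
    using I by blast
  define next_ideal where "next_ideal I = (SOME J. J \<in> S \<and> I \<subset> J)" for I
  have step: "next_ideal I \<in> S \<and> I \<subset> next_ideal I" if "I \<in> S" for I
    unfolding next_ideal_def by (rule someI_ex[OF no[OF that]])
  define f where "f k = (next_ideal ^^ k) I0" for k :: nat
  have fS: "f k \<in> S" for k by (induction k) (auto simp: f_def I0 step)
  have mono: "f k \<subset> f (Suc k)" for k using step[OF fS] by (simp add: f_def)
  then have "strict_mono f" by (simp add: strict_mono_Suc_iff)
  have "subset.chain {I. ideal I R} (range f)"
    unfolding subset_chain_def
  proof (intro conjI ballI)
    show "range f \<subseteq> {I. ideal I R}" using fS ideal by blast
    fix A B assume "A \<in> range f" "B \<in> range f"
    then obtain i j where "A = f i" "B = f j" by blast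
    then show "A \<subseteq> B \<or> B \<subseteq> A"
      using strict_mono_less_eq[OF \<open>strict_mono f\<close>] nat_le_linear by metis
  qed
  then have "\<Union>(range f) \<in> range f" by (intro ideal_chain_is_trivial) auto
  then obtain k where "\<Union>(range f) = f k" by blast
  then show False using mono[of k] by blast
qed

text \<open>For a prime N this is J R_N \<inter> R, the contraction of the extension of J to the
  localization at N.\<close>

definition sat :: "('a, 'b) ring_scheme \<Rightarrow> 'a set \<Rightarrow> 'a set \<Rightarrow> 'a set" where
  "sat R N J = {a \<in> carrier R. \<exists>s\<in>carrier R - N. s \<otimes>\<^bsub>R\<^esub> a \<in> J}"

text \<open>Ideals satisfying this are exactly the contractions of ideals of the localization at the
  prime \<open>N\<close>; working with them replaces the localization.\<close>

definition saturated :: "('a, 'b) ring_scheme \<Rightarrow> 'a set \<Rightarrow> 'a set \<Rightarrow> bool" where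
  "saturated R N J \<longleftrightarrow> ideal J R \<and>
     (\<forall>a\<in>carrier R. \<forall>s\<in>carrier R. s \<notin> N \<longrightarrow> s \<otimes>\<^bsub>R\<^esub> a \<in> J \<longrightarrow> a \<in> J)"

lemma saturatedD:
  "saturated R N J \<Longrightarrow> s \<otimes>\<^bsub>R\<^esub> a \<in> J \<Longrightarrow> a \<in> carrier R \<Longrightarrow> s \<in> carrier R \<Longrightarrow> s \<notin> N \<Longrightarrow> a \<in> J"
  unfolding saturated_def by blast

lemma saturated_ideal: "saturated R N J \<Longrightarrow> ideal J R"
  unfolding saturated_def by blast

lemma saturated_mono: "saturated R Q J \<Longrightarrow> Q \<subseteq> N \<Longrightarrow> saturated R N J"
  unfolding saturated_def by blast

lemma satE:
  assumes "a \<in> sat R N J"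
  obtains s where "a \<in> carrier R" "s \<in> carrier R" "s \<notin> N" "s \<otimes>\<^bsub>R\<^esub> a \<in> J"
  using assms unfolding sat_def by blast

lemma satI: "a \<in> carrier R \<Longrightarrow> s \<in> carrier R \<Longrightarrow> s \<notin> N \<Longrightarrow> s \<otimes>\<^bsub>R\<^esub> a \<in> J \<Longrightarrow> a \<in> sat R N J"
  unfolding sat_def by blast

lemma sat_mono: "J \<subseteq> K \<Longrightarrow> sat R N J \<subseteq> sat R N K"
  unfolding sat_def by blast

lemma sat_least: "J \<subseteq> K \<Longrightarrow> saturated R N K \<Longrightarrow> sat R N J \<subseteq> K"
  by (auto elim!: satE dest: saturatedD)

lemma primeideal_ideal: "primeideal P R \<Longrightarrow> ideal P R"
  by (simp add: primeideal_def)

lemma primeideal_proper: "primeideal P R \<Longrightarrow> \<one>\<^bsub>R\<^esub> \<notin> P"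
  using ideal.one_imp_carrier[of P R] primeideal.I_notcarr[of P R] by (auto simp: primeideal_def)

context cring
begin

lemma sat_supset:
  assumes "primeideal N R" "ideal J R"
  shows "J \<subseteq> sat R N J"
proof
  fix a assume a: "a \<in> J"
  show "a \<in> sat R N J"
    by (rule satI[where s = \<one>]) (use a assms primeideal_proper ideal_carrier in auto)
qed

lemma sat_saturated:
  assumes N: "primeideal N R" and J: "ideal J R"
  shows "saturated R N (sat R N J)"
  unfolding saturated_def
proof (intro conjI ballI impI)
  have mult: "s \<otimes> t \<notin> N" if "s \<in> carrier R" "t \<in> carrier R" "s \<notin> N" "t \<notin> N" for s t
    using primeideal.I_prime[OF N] that by blast
  show "ideal (sat R N J) R"
  proof (rule idealI')
    show "sat R N J \<subseteq> carrier R" by (auto elim: satE)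
    show "\<zero> \<in> sat R N J" using sat_supset[OF N J] ideal_zero[OF J] by blast
    show "a \<oplus> b \<in> sat R N J" if ab: "a \<in> sat R N J" "b \<in> sat R N J" for a b
    proof -
      obtain s where s: "a \<in> carrier R" "s \<in> carrier R" "s \<notin> N" "s \<otimes> a \<in> J" using ab(1) by (rule satE)
      obtain t where t: "b \<in> carrier R" "t \<in> carrier R" "t \<notin> N" "t \<otimes> b \<in> J" using ab(2) by (rule satE)
      have "(s \<otimes> t) \<otimes> (a \<oplus> b) = t \<otimes> (s \<otimes> a) \<oplus> s \<otimes> (t \<otimes> b)" using s t by algebra
      also have "\<dots> \<in> J"
        using ideal_lmult[OF J s(4) t(2)] ideal_lmult[OF J t(4) s(2)] by (rule ideal_add[OF J])
      finally show ?thesis using s t mult by (intro satI[where s = "s \<otimes> t"]) auto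
    qed
    show "x \<otimes> a \<in> sat R N J" if a: "a \<in> sat R N J" and x: "x \<in> carrier R" for a x
    proof -
      obtain s where s: "a \<in> carrier R" "s \<in> carrier R" "s \<notin> N" "s \<otimes> a \<in> J" using a by (rule satE)
      have "s \<otimes> (x \<otimes> a) = x \<otimes> (s \<otimes> a)" using s x by algebra
      also have "\<dots> \<in> J" using J s(4) x by (rule ideal_lmult)
      finally show ?thesis using s x by (intro satI[where s = s]) auto
    qed
  qed
  fix a s assume as: "a \<in> carrier R" "s \<in> carrier R" "s \<notin> N" "s \<otimes> a \<in> sat R N J"
  obtain t where t: "t \<in> carrier R" "t \<notin> N" "t \<otimes> (s \<otimes> a) \<in> J" using as(4) by (rule satE)
  then have "(t \<otimes> s) \<otimes> a \<in> J" using as by (simp add: m_assoc)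
  then show "a \<in> sat R N J" using as t mult by (intro satI[where s = "t \<otimes> s"]) auto
qed

lemma ideal_sat: "primeideal N R \<Longrightarrow> ideal J R \<Longrightarrow> ideal (sat R N J) R"
  using sat_saturated saturated_ideal by blast

lemma principal_comb_ideal: "a \<in> carrier R \<Longrightarrow> ideal J R \<Longrightarrow> ideal (comb R a (carrier R) J) R"
  by (simp add: comb_ideal oneideal)

lemma principal_comb_mem: "a \<in> carrier R \<Longrightarrow> ideal J R \<Longrightarrow> a \<in> comb R a (carrier R) J"
  using comb_mult_mem[OF oneideal, of J a \<one>] by simp

lemma principal_comb_supset: "a \<in> carrier R \<Longrightarrow> ideal J R \<Longrightarrow> J \<subseteq> comb R a (carrier R) J"
  by (simp add: comb_supset_right oneideal)

lemma principal_comb_least: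
  "ideal L R \<Longrightarrow> J \<subseteq> L \<Longrightarrow> a \<in> L \<Longrightarrow> comb R a (carrier R) J \<subseteq> L"
  by (rule comb_least) (auto intro: ideal_rmult)

end

locale cring_noetherian = cring R + noetherian_ring R for R (structure)
begin

text \<open>Nakayama's lemma for the localization at \<open>N\<close>. Finite generation enters through the choice of
  a maximal proper submodule of \<open>G / K\<close>.\<close>

lemma saturated_nakayama:
  assumes N: "primeideal N R" and G: "saturated R N G" and K: "saturated R N K" and "K \<subseteq> G"
    and x: "x \<in> N"
    and ex: "\<And>a. a \<in> G \<Longrightarrow> \<exists>s\<in>carrier R - N. \<exists>b\<in>K. \<exists>c\<in>G. s \<otimes> a = x \<otimes> c \<oplus> b"
  shows "G = K"
proof (rule ccontr)
  assume "G \<noteq> K"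
  let ?S = "{H. saturated R N H \<and> K \<subseteq> H \<and> H \<subset> G}"
  have "K \<in> ?S" using K \<open>K \<subseteq> G\<close> \<open>G \<noteq> K\<close> by blast
  then obtain H where H: "H \<in> ?S" and max: "\<And>J. J \<in> ?S \<Longrightarrow> H \<subseteq> J \<Longrightarrow> J = H"
    by (rule exists_maximal_ideal_in) (auto dest: saturated_ideal)
  have iH: "ideal H R" and iG: "ideal G R" and iN: "ideal N R"
    using H G N saturated_ideal primeideal_ideal by blast+
  obtain g where g: "g \<in> G" "g \<notin> H" using H by blast
  have gc: "g \<in> carrier R" and xc: "x \<in> carrier R" using g iG x iN ideal_carrier by blast+
  let ?H = "sat R N (comb R g (carrier R) H)"
  have iC: "ideal (comb R g (carrier R) H) R" using gc iH by (rule principal_comb_ideal)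
  have "saturated R N ?H" using sat_saturated[OF N iC] .
  moreover have "H \<subseteq> ?H" "g \<in> ?H"
    using principal_comb_supset[OF gc iH] principal_comb_mem[OF gc iH] sat_supset[OF N iC] by blast+
  moreover have "?H \<subseteq> G"
    using H g by (intro sat_least[OF _ G] principal_comb_least[OF iG]) auto
  \<comment> \<open>By maximality of H, the quotient G / H is generated by g locally at N.\<close>
  ultimately have HG: "?H = G" using max[of ?H] H g by blast
  obtain s b c where sbc: "s \<in> carrier R" "s \<notin> N" "b \<in> K" "c \<in> G" "s \<otimes> g = x \<otimes> c \<oplus> b"
    using ex[OF g(1)] by blast
  have "c \<in> ?H" using sbc HG by simp
  then obtain t where t: "c \<in> carrier R" "t \<in> carrier R" "t \<notin> N" "t \<otimes> c \<in> comb R g (carrier R) H"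
    by (rule satE)
  obtain e h where eh: "e \<in> carrier R" "h \<in> H" "t \<otimes> c = g \<otimes> e \<oplus> h" using t(4) by (rule combE)
  have cl: "h \<in> carrier R" "b \<in> carrier R" using eh sbc iH K saturated_ideal ideal_carrier by blast+
  \<comment> \<open>The determinant trick in rank one: this factor kills g modulo H, and it is a
    unit locally because s t lies outside N and x inside.\<close>
  have "(s \<otimes> t \<ominus> x \<otimes> e) \<otimes> g = t \<otimes> (s \<otimes> g) \<ominus> x \<otimes> (g \<otimes> e)"
    using sbc(1) t gc xc eh(1) by algebra
  also have "\<dots> = x \<otimes> (t \<otimes> c) \<oplus> t \<otimes> b \<ominus> x \<otimes> (g \<otimes> e)"
    unfolding sbc(5) using sbc(1) t(1,2) gc xc eh(1) cl by algebra
  also have "\<dots> = x \<otimes> h \<oplus> t \<otimes> b"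
    unfolding eh(3) using t(1,2) gc xc eh(1) cl by algebra
  also have "\<dots> \<in> H" using iH eh sbc H xc t by (intro ideal_add ideal_lmult) auto
  finally have in_H: "(s \<otimes> t \<ominus> x \<otimes> e) \<otimes> g \<in> H" .
  have "s \<otimes> t \<ominus> x \<otimes> e \<notin> N"
  proof
    assume "s \<otimes> t \<ominus> x \<otimes> e \<in> N"
    then have "x \<otimes> e \<oplus> (s \<otimes> t \<ominus> x \<otimes> e) \<in> N"
      using x eh iN by (intro ideal_add ideal_rmult) auto
    moreover have "x \<otimes> e \<oplus> (s \<otimes> t \<ominus> x \<otimes> e) = s \<otimes> t" using sbc(1) t(1,2) xc eh(1) by algebra
    ultimately show False using primeideal.I_prime[OF N] sbc t by auto
  qed
  then have "g \<in> H"
    using saturatedD[OF _ in_H gc] H sbc t xc eh by auto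
  then show False using g by simp
qed

text \<open>If \<open>N\<close> is minimal over \<open>L0\<close>, then the localization of \<open>R / L0\<close> at \<open>N\<close> is artinian: whenever
  \<open>L \<supseteq> L0\<close> is saturated and proper, a maximal annihilator \<open>(L : g)\<close> is a prime between \<open>L0\<close> and
  \<open>N\<close>, hence equals \<open>N\<close>, so \<open>L\<close> and \<open>L + (g)\<close> have simple quotient.\<close>

lemma saturated_dcc:
  assumes N: "primeideal N R" and "ideal L0 R"
    and minimal: "\<And>Q. primeideal Q R \<Longrightarrow> L0 \<subseteq> Q \<Longrightarrow> Q \<subseteq> N \<Longrightarrow> Q = N"
    and J: "\<And>k. saturated R N (J k)" "\<And>k. L0 \<subseteq> J k" "\<And>k. J (Suc k) \<subseteq> J k"
  shows "\<exists>k. J (Suc k) = J k"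
proof (rule ccontr)
  \<comment> \<open>Noetherian induction: L will be maximal among the ideals above \<open>L0\<close>
    that are not good.\<close>
  define good where "good L \<longleftrightarrow> (\<forall>J. (\<forall>k. saturated R N (J k)) \<longrightarrow> (\<forall>k. L \<subseteq> J k) \<longrightarrow>
    (\<forall>k. J (Suc k) \<subseteq> J k) \<longrightarrow> (\<exists>m. \<forall>k\<ge>m. J k = J m))" for L
  have goodD: "\<exists>m. \<forall>k\<ge>m. J k = J m"
    if "good L" "\<And>k. saturated R N (J k)" "\<And>k. L \<subseteq> J k" "\<And>k. J (Suc k) \<subseteq> J k" for L and J :: "nat \<Rightarrow> _"
    using that unfolding good_def by blast
  assume no: "\<not> ?thesis"
  have "\<not> good L0"
  proof
    assume "good L0"
    then obtain m where "\<forall>k\<ge>m. J k = J m" using goodD[of L0 J] J by blast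
    then have "J (Suc m) = J m" using le_SucI[OF order_refl] by blast
    then show False using no by blast
  qed
  let ?S = "{L. ideal L R \<and> L0 \<subseteq> L \<and> \<not> good L}"
  have "L0 \<in> ?S" using assms(2) \<open>\<not> good L0\<close> by blast
  then obtain L where L: "L \<in> ?S" and max: "\<And>M. M \<in> ?S \<Longrightarrow> L \<subseteq> M \<Longrightarrow> M = L"
    by (rule exists_maximal_ideal_in) auto
  have iL: "ideal L R" and iN: "ideal N R" using L N primeideal_ideal by blast+
  have larger: "good M" if "ideal M R" "L \<subset> M" for M using max[of M] L that by blast
  obtain J where J: "\<And>k. saturated R N (J k)" "\<And>k. L \<subseteq> J k" "\<And>k. J (Suc k) \<subseteq> J k"
    and bad: "\<And>m. \<exists>k\<ge>m. J k \<noteq> J m"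
    using L unfolding good_def by blast
  have anti: "J k \<subseteq> J m" if "m \<le> k" for k m
    using that J(3) by (induction k rule: dec_induct) blast+
  have iJ: "ideal (J k) R" for k using J(1) saturated_ideal by blast
  \<comment> \<open>The members of the chain are saturated and contain L, hence contain its
    saturation; if that were larger, it would be good.\<close>
  have "sat R N L = L"
  proof (rule ccontr)
    assume "sat R N L \<noteq> L"
    then have "good (sat R N L)"
      using larger[OF ideal_sat[OF N iL]] sat_supset[OF N iL] by blast
    moreover have "sat R N L \<subseteq> J k" for k using sat_least[OF J(2) J(1)] .
    ultimately show False using goodD[of "sat R N L" J] J bad by blast
  qed
  then have satL: "saturated R N L" using sat_saturated[OF N iL] by simp
  have "L \<noteq> carrier R"
  proof
    assume "L = carrier R"
    then have "J k = carrier R" for k using J(2)[of k] ideal_subset[OF iJ[of k]] by blast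
    then show False using bad by simp
  qed
  let ?ann = "\<lambda>g. pull R g (carrier R) L"
  obtain g where g: "g \<in> carrier R" "g \<notin> L"
    and gmax: "\<And>h. h \<in> carrier R - L \<Longrightarrow> ?ann g \<subseteq> ?ann h \<Longrightarrow> ?ann h = ?ann g"
  proof -
    obtain g0 where "g0 \<in> carrier R - L" using \<open>L \<noteq> carrier R\<close> ideal_subset[OF iL] by blast
    then have "?ann g0 \<in> ?ann ` (carrier R - L)" by (rule imageI)
    then obtain M where M: "M \<in> ?ann ` (carrier R - L)"
      and max: "\<And>J. J \<in> ?ann ` (carrier R - L) \<Longrightarrow> M \<subseteq> J \<Longrightarrow> J = M"
      by (rule exists_maximal_ideal_in) (auto intro: pull_ideal oneideal iL)
    from M obtain g where "g \<in> carrier R - L" "M = ?ann g" by blast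
    then show ?thesis using that[of g] max by blast
  qed
  have ann_ideal: "ideal (?ann g) R" using pull_ideal[OF oneideal iL] g by blast
  have "primeideal (?ann g) R"
  proof (rule primeidealI[OF ann_ideal])
    show "cring R" by (rule is_cring)
    show "carrier R \<noteq> ?ann g"
      using g by (auto simp: pull_def set_eq_iff intro!: exI[of _ \<one>])
    fix a b assume ab: "a \<in> carrier R" "b \<in> carrier R" "a \<otimes> b \<in> ?ann g"
    show "a \<in> ?ann g \<or> b \<in> ?ann g"
    proof (rule disjCI)
      assume "b \<notin> ?ann g"
      then have gb: "g \<otimes> b \<in> carrier R - L" using ab g by (auto simp: pull_def)
      have "?ann g \<subseteq> ?ann (g \<otimes> b)"
      proof
        fix u assume "u \<in> ?ann g"
        then have u: "u \<in> carrier R" "g \<otimes> u \<in> L" by (auto simp: pull_def)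
        have "g \<otimes> b \<otimes> u = b \<otimes> (g \<otimes> u)" using u ab g by algebra
        then show "u \<in> ?ann (g \<otimes> b)" using u ab iL by (auto simp: pull_def intro: ideal_lmult)
      qed
      then have "?ann (g \<otimes> b) = ?ann g" using gmax[OF gb] by blast
      moreover have "a \<in> ?ann (g \<otimes> b)"
        using ab g by (simp add: pull_def m_ac)
      ultimately show "a \<in> ?ann g" by simp
    qed
  qed
  moreover have "L \<subseteq> ?ann g"
    using ideal_subset[OF iL] iL g by (auto simp: pull_def intro: ideal_lmult)
  moreover have "?ann g \<subseteq> N"
    using satL g unfolding saturated_def by (auto simp: pull_def m_comm)
  ultimately have annN: "?ann g = N" using minimal[of "?ann g"] L by blast
  let ?M = "\<lambda>J. comb R g (carrier R) J"
  have iM: "ideal (?M L) R" and MJ: "ideal (?M (J k)) R" for k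
    using principal_comb_ideal[OF g(1)] iL iJ by auto
  have goodM: "good (?M L)"
    using larger[OF iM] principal_comb_supset[OF g(1) iL] principal_comb_mem[OF g(1) iL] g by blast
  obtain m1 where m1: "\<And>k. k \<ge> m1 \<Longrightarrow> sat R N (?M (J k)) = sat R N (?M (J m1))"
  proof -
    have "\<exists>m. \<forall>k\<ge>m. sat R N (?M (J k)) = sat R N (?M (J m))"
    proof (rule goodD[OF goodM])
      show "saturated R N (sat R N (?M (J k)))" for k using sat_saturated[OF N MJ] .
      show "?M L \<subseteq> sat R N (?M (J k))" for k
        using sat_supset[OF N MJ[of k]] comb_mono[of "carrier R" "carrier R" L "J k" R g] J(2)[of k] by blast
      show "sat R N (?M (J (Suc k))) \<subseteq> sat R N (?M (J k))" for k
        by (intro sat_mono comb_mono order_refl J(3))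
    qed
    then show ?thesis using that by blast
  qed
  \<comment> \<open>Otherwise the whole chain lies above L + (g), which is good.\<close>
  have "\<exists>k. g \<notin> J k"
  proof (rule ccontr)
    assume "\<not> ?thesis"
    then have "?M L \<subseteq> J k" for k
      using principal_comb_least[OF iJ J(2)] by blast
    then show False using goodD[OF goodM, of J] J bad by blast
  qed
  then obtain m2 where m2: "g \<notin> J m2" by blast
  define m where "m = max m1 m2"
  have "J k = J m" if "k \<ge> m" for k
  proof
    show "J k \<subseteq> J m" using anti that by blast
    show "J m \<subseteq> J k"
    proof
      fix a assume a: "a \<in> J m"
      have "sat R N (?M (J k)) = sat R N (?M (J m))"
        using m1[of k] m1[of m] that by (simp add: m_def)
      moreover have "a \<in> sat R N (?M (J m))"
        using a sat_supset[OF N MJ[of m]] principal_comb_supset[OF g(1) iJ[of m]] by blast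
      ultimately have "a \<in> sat R N (?M (J k))" by simp
      then obtain s where s: "a \<in> carrier R" "s \<in> carrier R" "s \<notin> N" "s \<otimes> a \<in> ?M (J k)" by (rule satE)
      obtain c b where cb: "c \<in> carrier R" "b \<in> J k" "s \<otimes> a = g \<otimes> c \<oplus> b" using s(4) by (rule combE)
      have b: "b \<in> carrier R" "b \<in> J m" using cb iJ ideal_carrier anti[OF that] by blast+
      have "g \<otimes> c \<in> J m"
      proof (rule ideal_add_cancel[OF iJ b(2)])
        show "b \<oplus> g \<otimes> c \<in> J m"
          using cb b a_comm[of b "g \<otimes> c"] g a s ideal_lmult[OF iJ a, of s] by simp
      qed (use cb g in simp)
      moreover have "g \<notin> J m" using m2 anti[of m2 m] by (auto simp: m_def)
      \<comment> \<open>The saturations of J k + (g) are already constant, so only the multiple of g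
        is in question. Since g is not in J m, its coefficient lies in N = (L : g), and g c falls
        into L.\<close>
      ultimately have "c \<in> N"
        using saturatedD[OF J(1)[of m], of c g] cb g by (auto simp: m_comm)
      then have "g \<otimes> c \<in> L" using annN by (auto simp: pull_def)
      then have "s \<otimes> a \<in> J k" using cb J(2)[of k] by (auto intro: ideal_add[OF iJ])
      then show "a \<in> J k" using saturatedD[OF J(1)] s by blast
    qed
  qed
  then show False using bad by blast
qed

text \<open>Instead of the symbolic powers of \<open>Q\<close>, the saturations of the ideals \<open>P + (y\<^sup>k)\<close> for one
  element \<open>y\<close> suffice.\<close>

theorem principal_ideal_theorem:
  assumes P: "primeideal P R" and Q: "primeideal Q R" and N: "primeideal N R"
    and "P \<subset> Q" "Q \<subset> N" and x: "x \<in> N"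
  shows "\<exists>Q'. primeideal Q' R \<and> P \<subseteq> Q' \<and> x \<in> Q' \<and> Q' \<subset> N"
proof (rule ccontr)
  assume no: "\<not> ?thesis"
  have iP: "ideal P R" and iQ: "ideal Q R" and iN: "ideal N R"
    using P Q N primeideal_ideal by blast+
  have xc: "x \<in> carrier R" using x iN ideal_carrier by blast
  have xQ: "x \<notin> Q" using no Q \<open>P \<subset> Q\<close> \<open>Q \<subset> N\<close> by blast
  obtain y where y: "y \<in> Q" "y \<notin> P" using \<open>P \<subset> Q\<close> by blast
  have yc: "y \<in> carrier R" using y iQ ideal_carrier by blast
  define C where "C k = comb R (y [^] (k::nat)) (carrier R) P" for k
  define K where "K k = sat R Q (C k)" for k
  have iC: "ideal (C k) R" for k unfolding C_def using principal_comb_ideal iP yc by simp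
  have satK: "saturated R Q (K k)" for k unfolding K_def using sat_saturated[OF Q iC] .
  have satK': "saturated R N (K k)" for k using saturated_mono[OF satK] \<open>Q \<subset> N\<close> by blast
  have iK: "ideal (K k) R" for k using satK saturated_ideal by blast
  have PK: "P \<subseteq> K k" for k
    using sat_supset[OF Q iC[of k]] principal_comb_supset[OF nat_pow_closed[OF yc] iP, of k]
    unfolding K_def C_def by blast
  have yK: "y [^] k \<in> K k" for k
    using sat_supset[OF Q iC[of k]] principal_comb_mem[OF nat_pow_closed[OF yc] iP, of k]
    unfolding K_def C_def by blast
  have Kanti: "K (Suc k) \<subseteq> K k" for k
  proof -
    have "C (Suc k) \<subseteq> C k"
      unfolding C_def[of "Suc k"]
    proof (rule principal_comb_least[OF iC])
      show "P \<subseteq> C k" unfolding C_def using principal_comb_supset[OF _ iP] yc by simp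
      show "y [^] Suc k \<in> C k"
        unfolding C_def using comb_mult_mem[OF oneideal iP, of "y [^] k" y] yc by simp
    qed
    then show ?thesis unfolding K_def by (rule sat_mono)
  qed
  let ?x = "\<lambda>J. comb R x (carrier R) J"
  have ixK: "ideal (?x (K k)) R" for k using principal_comb_ideal[OF xc iK] .
  \<comment> \<open>The assumption \<open>no\<close> makes N minimal over P + (x), which gives the
    descending chain condition above P + (x).\<close>
  have "\<exists>k. sat R N (?x (K (Suc k))) = sat R N (?x (K k))"
  proof (rule saturated_dcc[OF N principal_comb_ideal[OF xc iP]])
    fix Q' assume Q': "primeideal Q' R" "?x P \<subseteq> Q'" "Q' \<subseteq> N"
    then have "P \<subseteq> Q'" "x \<in> Q'"
      using principal_comb_supset[OF xc iP] principal_comb_mem[OF xc iP] by blast+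
    then show "Q' = N" using no Q' by blast
  next
    show "saturated R N (sat R N (?x (K k)))" for k using sat_saturated[OF N ixK] .
    show "?x P \<subseteq> sat R N (?x (K k))" for k
      using sat_supset[OF N ixK[of k]] comb_mono[of "carrier R" "carrier R" P "K k" R x] PK by blast
    show "sat R N (?x (K (Suc k))) \<subseteq> sat R N (?x (K k))" for k
      by (intro sat_mono comb_mono order_refl Kanti)
  qed
  then obtain k where k: "sat R N (?x (K (Suc k))) = sat R N (?x (K k))" by blast
  \<comment> \<open>As x is not in Q and K k is saturated at Q, the coefficient c of x is again in K
    k. So K k = x K k + K (k + 1) locally at N, and Nakayama applies.\<close>
  have "K k = K (Suc k)"
  proof (rule saturated_nakayama[OF N satK' satK' Kanti x])
    fix a assume a: "a \<in> K k"
    then have "a \<in> sat R N (?x (K (Suc k)))"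
      using k sat_supset[OF N ixK[of k]] principal_comb_supset[OF xc iK[of k]] by blast
    then obtain s where s: "a \<in> carrier R" "s \<in> carrier R" "s \<notin> N" "s \<otimes> a \<in> ?x (K (Suc k))" by (rule satE)
    obtain c b where cb: "c \<in> carrier R" "b \<in> K (Suc k)" "s \<otimes> a = x \<otimes> c \<oplus> b" using s(4) by (rule combE)
    have b: "b \<in> K k" "b \<in> carrier R" using cb Kanti iK ideal_carrier by blast+
    have "x \<otimes> c \<in> K k"
    proof (rule ideal_add_cancel[OF iK b(1)])
      show "b \<oplus> x \<otimes> c \<in> K k"
        using cb b a_comm[of b "x \<otimes> c"] xc ideal_lmult[OF iK a, of s] s by simp
    qed (use xc cb in simp)
    then have "c \<in> K k" using saturatedD[OF satK] xQ xc cb by blast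
    then show "\<exists>s\<in>carrier R - N. \<exists>b\<in>K (Suc k). \<exists>c\<in>K k. s \<otimes> a = x \<otimes> c \<oplus> b"
      using s cb by blast
  qed
  \<comment> \<open>Cancelling y^k modulo P puts t into (y) + P, hence into Q, although t was chosen
    outside Q.\<close>
  then have "y [^] k \<in> K (Suc k)" using yK[of k] by simp
  then obtain t where t: "t \<in> carrier R" "t \<notin> Q" "t \<otimes> y [^] k \<in> C (Suc k)"
    unfolding K_def by (rule satE)
  obtain c p where cp: "c \<in> carrier R" "p \<in> P" "t \<otimes> y [^] k = y [^] Suc k \<otimes> c \<oplus> p"
    using t(3) unfolding C_def by (rule combE)
  have pc: "p \<in> carrier R" "y [^] k \<in> carrier R" using cp iP ideal_carrier yc by auto
  have "y [^] k \<otimes> (t \<ominus> y \<otimes> c) = t \<otimes> y [^] k \<ominus> (y [^] k \<otimes> y) \<otimes> c" using pc t(1) yc cp(1) by algebra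
  also have "\<dots> = p" unfolding cp(3) nat_pow_Suc using pc yc cp(1) by algebra
  finally have in_P: "y [^] k \<otimes> (t \<ominus> y \<otimes> c) \<in> P" using cp by simp
  have "y [^] k \<notin> P"
  proof (induction k)
    case 0
    then show ?case using primeideal_proper[OF P] by simp
  next
    case (Suc k)
    then show ?case using primeideal.I_prime[OF P, of "y [^] k" y] y yc by auto
  qed
  then have "t \<ominus> y \<otimes> c \<in> P" using primeideal.I_prime[OF P _ _ in_P] pc t yc cp by auto
  then have "y \<otimes> c \<oplus> (t \<ominus> y \<otimes> c) \<in> Q"
    using y cp \<open>P \<subset> Q\<close> iQ by (intro ideal_add ideal_rmult) auto
  moreover have "y \<otimes> c \<oplus> (t \<ominus> y \<otimes> c) = t" using t(1) yc cp(1) by algebra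
  ultimately show False using t by simp
qed

end

definition prime_chain :: "('a, 'b) ring_scheme \<Rightarrow> (nat \<Rightarrow> 'a set) \<Rightarrow> nat \<Rightarrow> bool" where
  "prime_chain R P d \<longleftrightarrow> (\<forall>i\<le>d. primeideal (P i) R) \<and> (\<forall>i<d. P i \<subset> P (Suc i))"

text \<open>Work down from the top: the principal ideal theorem replaces the last prime but one by a
  prime containing x, and the shorter chain ending there again has x in its top.\<close>

lemma (in cring_noetherian) prime_chain_through:
  assumes "prime_chain R P (Suc d)" "x \<in> P (Suc d)"
  shows "\<exists>Q. prime_chain R Q (Suc d) \<and> Q 0 = P 0 \<and> Q (Suc d) = P (Suc d) \<and> x \<in> Q 1"
  using assms
proof (induction d arbitrary: P)
  case 0
  then show ?case by (intro exI[of _ P]) simp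
next
  case (Suc d)
  have P: "primeideal (P i) R" if "i \<le> Suc (Suc d)" for i
    using Suc.prems that by (simp add: prime_chain_def)
  have lt: "P i \<subset> P (Suc i)" if "i < Suc (Suc d)" for i
    using Suc.prems(1) that unfolding prime_chain_def by blast
  obtain Q' where Q': "primeideal Q' R" "P d \<subset> Q'" "x \<in> Q'" "Q' \<subset> P (Suc (Suc d))"
  proof (cases "x \<in> P (Suc d)")
    case True
    then show ?thesis using that[of "P (Suc d)"] P lt by simp
  next
    case False
    then have "x \<notin> P d" using lt[of d] by auto
    moreover obtain Q' where "primeideal Q' R \<and> P d \<subseteq> Q' \<and> x \<in> Q' \<and> Q' \<subset> P (Suc (Suc d))"
      using principal_ideal_theorem[of "P d" "P (Suc d)" "P (Suc (Suc d))" x] P lt Suc.prems(2) by auto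
    ultimately show ?thesis using that by blast
  qed
  let ?P = "P(Suc d := Q')"
  have "prime_chain R ?P (Suc d)"
    using P lt Q' unfolding prime_chain_def by (auto simp: less_Suc_eq)
  from Suc.IH[OF this]
  obtain Q where Q: "prime_chain R Q (Suc d)" "Q 0 = P 0" "Q (Suc d) = Q'" "x \<in> Q 1"
    using Q'(3) by auto
  show ?case
  proof (intro exI[of _ "Q(Suc (Suc d) := P (Suc (Suc d)))"] conjI)
    show "prime_chain R (Q(Suc (Suc d) := P (Suc (Suc d)))) (Suc (Suc d))"
      using Q Q' P[of "Suc (Suc d)"] unfolding prime_chain_def by (auto simp: less_Suc_eq le_Suc_eq)
  qed (use Q in auto)
qed

section \<open>Parameters of a regular local ring\<close>

text \<open>The ideal J + (xs). Elements are adjoined from the head of the list, so inductions on it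
  generalize over J.\<close>

definition gens :: "('a, 'b) ring_scheme \<Rightarrow> 'a list \<Rightarrow> 'a set \<Rightarrow> 'a set" where
  "gens R xs J = fold (\<lambda>x J. comb R x (carrier R) J) xs J"

lemma gens_Nil [simp]: "gens R [] J = J"
  by (simp add: gens_def)

lemma gens_Cons [simp]: "gens R (x # xs) J = gens R xs (comb R x (carrier R) J)"
  by (simp add: gens_def)

lemma gens_append: "gens R (xs @ ys) J = gens R ys (gens R xs J)"
  by (simp add: gens_def)

context cring
begin

lemma gens_ideal: "set xs \<subseteq> carrier R \<Longrightarrow> ideal J R \<Longrightarrow> ideal (gens R xs J) R"
  by (induction xs arbitrary: J) (auto intro: principal_comb_ideal)

lemma gens_supset: "set xs \<subseteq> carrier R \<Longrightarrow> ideal J R \<Longrightarrow> J \<subseteq> gens R xs J"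
proof (induction xs arbitrary: J)
  case (Cons x xs)
  then show ?case
    using principal_comb_supset[of x J] principal_comb_ideal[of x J] by fastforce
qed simp

lemma gens_mem: "set xs \<subseteq> carrier R \<Longrightarrow> ideal J R \<Longrightarrow> set xs \<subseteq> gens R xs J"
proof (induction xs arbitrary: J)
  case (Cons x xs)
  then have "ideal (comb R x (carrier R) J) R" by (simp add: principal_comb_ideal)
  moreover have "x \<in> comb R x (carrier R) J" using Cons.prems by (simp add: principal_comb_mem)
  ultimately show ?case
    using Cons gens_supset[of xs "comb R x (carrier R) J"] by auto
qed simp

lemma gens_least: "ideal L R \<Longrightarrow> J \<subseteq> L \<Longrightarrow> set xs \<subseteq> L \<Longrightarrow> gens R xs J \<subseteq> L"
  by (induction xs arbitrary: J) (auto simp: principal_comb_least)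

text \<open>Each x is annihilated by n modulo J, so adjoining it contributes a quotient of R /
  n.\<close>

lemma qlength_gens_le:
  assumes n: "ideal n R" and max: "qlength R (carrier R) n = 1"
    and "ideal J R" "set xs \<subseteq> carrier R" "\<And>x a. x \<in> set xs \<Longrightarrow> a \<in> n \<Longrightarrow> x \<otimes> a \<in> J"
  shows "qlength R (gens R xs J) J \<le> enat (length xs)"
  using assms(3-)
proof (induction xs arbitrary: J)
  case (Cons x xs)
  let ?J = "comb R x (carrier R) J"
  have x: "x \<in> carrier R" and J: "ideal ?J R" and sub: "J \<subseteq> ?J"
    using Cons.prems by (auto simp: principal_comb_ideal principal_comb_supset)
  have "n \<subseteq> pull R x (carrier R) J"
    using Cons.prems(3)[of x] ideal_subset[OF n] by (auto simp: pull_def)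
  then have "qlength R ?J J \<le> 1"
    using qlength_comb_le[OF oneideal Cons.prems(1) x n] max by simp
  moreover have "qlength R (gens R xs ?J) ?J \<le> enat (length xs)"
    using Cons.prems J sub by (intro Cons.IH) auto
  moreover have "qlength R (gens R xs ?J) J = qlength R (gens R xs ?J) ?J + qlength R ?J J"
    using Cons.prems J sub by (intro qlength_add gens_ideal gens_supset) auto
  ultimately have "qlength R (gens R xs ?J) J \<le> enat (length xs) + 1"
    by (simp add: add_mono)
  then show ?case by (simp add: one_enat_def)
qed (simp add: zero_enat_def[symmetric])

end

section \<open>Noetherian local rings and chains of primes\<close>

locale local_noetherian = cring_noetherian +
  fixes n
  assumes max_n: "maximalideal n R" and unique_n: "\<And>m. maximalideal m R \<Longrightarrow> m = n"
begin

lemma ideal_n [simp]: "ideal n R"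
  using max_n by (simp add: maximalideal_def)

lemma prime_n: "primeideal n R"
  by (rule maximalideal_prime[OF max_n])

lemma proper_le_n:
  assumes "ideal J R" "J \<noteq> carrier R"
  shows "J \<subseteq> n"
proof -
  let ?S = "{K. ideal K R \<and> J \<subseteq> K \<and> K \<noteq> carrier R}"
  have "J \<in> ?S" using assms by simp
  then obtain M where M: "M \<in> ?S" and max: "\<And>K. K \<in> ?S \<Longrightarrow> M \<subseteq> K \<Longrightarrow> K = M"
    by (rule exists_maximal_ideal_in) auto
  have "maximalideal M R"
    using M max by (intro maximalidealI) blast+
  then show ?thesis using unique_n M by blast
qed

lemma prime_le_n: "primeideal P R \<Longrightarrow> P \<subseteq> n"
  using proper_le_n primeideal_ideal primeideal.I_notcarr by blast

text \<open>Elements outside n are units, so localizing at n changes nothing and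
  \<open>saturated_nakayama\<close> applies to arbitrary ideals.\<close>

lemma saturated_n:
  assumes J: "ideal J R"
  shows "saturated R n J"
  unfolding saturated_def
proof (intro conjI J ballI impI)
  fix a s assume as: "a \<in> carrier R" "s \<in> carrier R" "s \<notin> n" "s \<otimes> a \<in> J"
  let ?A = "pull R a (carrier R) J"
  have A: "ideal ?A R" using pull_ideal oneideal J as by blast
  have "s \<in> ?A" using as by (simp add: pull_def m_comm)
  then have "?A = carrier R" using proper_le_n[OF A] as by blast
  then have "\<one> \<in> ?A" by simp
  then show "a \<in> J" using as by (simp add: pull_def)
qed

text \<open>For H maximal among the ideals from W up to but excluding n, n = H + (g), so n^2 lies in
  H + (g^2). Then g = g^2 c + h with h in H, and 1 - g c is a unit.\<close>

lemma nakayama_square: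
  assumes W: "ideal W R" "W \<subseteq> n" and sub: "n \<subseteq> comb R \<one> (n \<cdot> n) W"
  shows "n = W"
proof (rule ccontr)
  assume "n \<noteq> W"
  let ?S = "{H. ideal H R \<and> W \<subseteq> H \<and> H \<subset> n}"
  have "W \<in> ?S" using W \<open>n \<noteq> W\<close> by blast
  then obtain H where H: "H \<in> ?S" and max: "\<And>K. K \<in> ?S \<Longrightarrow> H \<subseteq> K \<Longrightarrow> K = H"
    by (rule exists_maximal_ideal_in) auto
  have iH: "ideal H R" using H by blast
  obtain g where g: "g \<in> n" "g \<notin> H" using H by blast
  have gc: "g \<in> carrier R" using g ideal_carrier ideal_n by blast
  let ?G = "comb R g (carrier R) H" and ?G2 = "comb R (g \<otimes> g) (carrier R) H"
  have "?G \<subseteq> n" using H g by (intro principal_comb_least) auto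
  then have G: "?G = n"
    using max[of ?G] H g principal_comb_ideal[OF gc iH] principal_comb_supset[OF gc iH]
      principal_comb_mem[OF gc iH] by blast
  have iG2: "ideal ?G2 R" using principal_comb_ideal iH gc by simp
  have "n \<cdot> n \<subseteq> ?G2"
  proof
    fix s assume "s \<in> n \<cdot> n"
    then show "s \<in> ?G2"
    proof (induction s rule: ideal_prod.induct)
      case (prod i j)
      then have "i \<in> ?G" "j \<in> ?G" using G by auto
      then obtain a h b k where *: "a \<in> carrier R" "h \<in> H" "i = g \<otimes> a \<oplus> h"
        "b \<in> carrier R" "k \<in> H" "j = g \<otimes> b \<oplus> k"
        by (meson combE)
      have cl: "h \<in> carrier R" "k \<in> carrier R" using * iH ideal_carrier by blast+
      have "i \<otimes> j = (g \<otimes> g) \<otimes> (a \<otimes> b) \<oplus> ((g \<otimes> a) \<otimes> k \<oplus> j \<otimes> h)"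
        unfolding *(3,6) using *(1,4) cl gc by algebra
      also have "\<dots> \<in> ?G2"
        using * cl gc iH by (intro combI ideal_add[OF iH] ideal_lmult[OF iH]) auto
      finally show ?case .
    next
      case (sum s t)
      then show ?case using iG2 ideal_add by blast
    qed
  qed
  moreover have "W \<subseteq> ?G2"
    using H principal_comb_supset[of "g \<otimes> g" H] gc by auto
  ultimately have "comb R \<one> (n \<cdot> n) W \<subseteq> ?G2"
    using iG2 ideal_carrier[OF iG2] by (intro comb_least) auto
  then obtain c h where ch: "c \<in> carrier R" "h \<in> H" "g = (g \<otimes> g) \<otimes> c \<oplus> h"
    using g sub by (blast elim: combE)
  have hc: "h \<in> carrier R" using ch iH ideal_carrier by blast
  have "(\<one> \<ominus> g \<otimes> c) \<otimes> g = g \<ominus> (g \<otimes> g) \<otimes> c" using gc ch(1) by algebra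
  also have "\<dots> = ((g \<otimes> g) \<otimes> c \<oplus> h) \<ominus> (g \<otimes> g) \<otimes> c" using ch(3) by simp
  also have "\<dots> = h" using gc ch(1) hc by algebra
  finally have "(\<one> \<ominus> g \<otimes> c) \<otimes> g \<in> H" using ch by simp
  moreover have "\<one> \<ominus> g \<otimes> c \<notin> n"
  proof
    assume "\<one> \<ominus> g \<otimes> c \<in> n"
    then have "g \<otimes> c \<oplus> (\<one> \<ominus> g \<otimes> c) \<in> n" using g ch by (intro ideal_add ideal_rmult) auto
    moreover have "g \<otimes> c \<oplus> (\<one> \<ominus> g \<otimes> c) = \<one>" using gc ch(1) by algebra
    ultimately show False using primeideal_proper[OF prime_n] by simp
  qed
  ultimately have "g \<in> H" using saturatedD[OF saturated_n[OF iH]] gc ch by simp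
  then show False using g by simp
qed

text \<open>With n as its top the chain can be rerouted so that its second prime contains x;
  dropping the bottom prime costs one step. Thus killing one element lowers the dimension by at most
  one.\<close>

lemma prime_chain_step:
  assumes P: "prime_chain R P (Suc d)" and J: "ideal J R" "J \<subseteq> P 0" and x: "x \<in> n"
  shows "\<exists>Q. prime_chain R Q d \<and> comb R x (carrier R) J \<subseteq> Q 0 \<and> P 0 \<subset> Q 0"
proof -
  let ?P = "P(Suc d := n)"
  have "P (Suc d) \<subseteq> n" using P prime_le_n by (simp add: prime_chain_def)
  then have "prime_chain R ?P (Suc d)"
    using P prime_n unfolding prime_chain_def by (auto simp: less_Suc_eq)
  then obtain Q where Q: "prime_chain R Q (Suc d)" "Q 0 = P 0" "x \<in> Q 1"
    using prime_chain_through[of ?P d x] x by auto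
  have Q1: "primeideal (Q 1) R" "P 0 \<subset> Q 1"
    using Q unfolding prime_chain_def by auto
  have "comb R x (carrier R) J \<subseteq> Q 1"
    using Q1 primeideal_ideal J Q(3) by (intro principal_comb_least) auto
  moreover have "prime_chain R (\<lambda>i. Q (Suc i)) d" using Q(1) by (simp add: prime_chain_def)
  ultimately show ?thesis using Q1 by (intro exI[of _ "\<lambda>i. Q (Suc i)"]) simp
qed

text \<open>This combines Krull's height theorem (applied above \<open>J\<close>) with the fact that regular local rings
  are domains: the bottom of a chain of length \<open>d\<close> in a local ring with \<open>d\<close> generators is zero.\<close>

lemma prime_chain_bottom:
  assumes "n = gens R xs J" "ideal J R" "set xs \<subseteq> carrier R"
    and "prime_chain R P (length xs)" "J \<subseteq> P 0"
  shows "P 0 = J"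
  using assms
proof (induction xs arbitrary: J P)
  case Nil
  then show ?case using prime_le_n[of "P 0"] by (auto simp: prime_chain_def)
next
  case (Cons x xs)
  let ?J = "comb R x (carrier R) J"
  have xc: "x \<in> carrier R" using Cons.prems by simp
  have iJ: "ideal ?J R" using Cons.prems xc by (simp add: principal_comb_ideal)
  have xn: "x \<in> n" using gens_mem[of "x # xs" J] Cons.prems by auto
  obtain Q where Q: "prime_chain R Q (length xs)" "?J \<subseteq> Q 0" "P 0 \<subset> Q 0"
    using prime_chain_step[of P "length xs" J x] Cons.prems xn by auto
  have Q0: "Q 0 = ?J"
    by (rule Cons.IH[OF _ iJ _ Q(1,2)]) (use Cons.prems(1,3) in \<open>simp_all add: gens_def\<close>)
  have P0: "primeideal (P 0) R" using Cons.prems by (simp add: prime_chain_def)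
  then have iP: "ideal (P 0) R" by (rule primeideal_ideal)
  \<comment> \<open>Otherwise J + (x) = Q 0 would lie in P 0, which is properly contained in Q
    0.\<close>
  have xP: "x \<notin> P 0"
    using principal_comb_least[OF iP, of J x] Cons.prems Q Q0 by blast
  \<comment> \<open>An element x c + b of P 0 has c in P 0, because P 0 is prime and omits x; so P 0
    = x P 0 + J.\<close>
  show ?case
  proof (rule saturated_nakayama[OF prime_n _ _ _ xn])
    fix a assume a: "a \<in> P 0"
    then have "a \<in> ?J" using Q Q0 by blast
    then obtain c b where cb: "c \<in> carrier R" "b \<in> J" "a = x \<otimes> c \<oplus> b" by (rule combE)
    have b: "b \<in> P 0" "b \<in> carrier R" using cb Cons.prems ideal_carrier by blast+
    have "x \<otimes> c \<in> P 0"
      using ideal_add_cancel[OF iP b(1), of "x \<otimes> c"] a cb b xc by (simp add: a_comm)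
    then have "c \<in> P 0" using primeideal.I_prime[OF P0] xc cb xP by blast
    moreover have "\<one> \<otimes> a = x \<otimes> c \<oplus> b" using cb b xc by simp
    ultimately show "\<exists>s\<in>carrier R - n. \<exists>b\<in>J. \<exists>c\<in>P 0. s \<otimes> a = x \<otimes> c \<oplus> b"
      using cb primeideal_proper[OF prime_n] by blast
  qed (use Cons.prems saturated_n iP in auto)
qed

text \<open>Killing \<open>xs\<close> leaves a chain with as many steps as \<open>ys\<close> has
  members, and \<open>ys\<close> generates n over what was killed; \<open>prime_chain_bottom\<close>
  then identifies J + (xs) with the bottom of the chain. This is the source of the primality of X
  and Y.\<close>

lemma prime_chain_gens:
  assumes "n = gens R (xs @ ys) J" "ideal J R" "set (xs @ ys) \<subseteq> carrier R"
    and "prime_chain R P (length (xs @ ys))" "J \<subseteq> P 0"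
  shows "\<exists>Q. prime_chain R Q (length ys) \<and> gens R xs J = Q 0"
  using assms
proof (induction xs arbitrary: J P)
  case Nil
  then show ?case using prime_chain_bottom[of ys J P] by auto
next
  case (Cons x xs)
  have xn: "x \<in> n" using gens_mem[of "x # xs @ ys" J] Cons.prems by auto
  obtain Q where "prime_chain R Q (length (xs @ ys))" "comb R x (carrier R) J \<subseteq> Q 0"
    using prime_chain_step[of P "length (xs @ ys)" J x] Cons.prems xn by auto
  then show ?case
    using Cons.IH[of "comb R x (carrier R) J" Q] Cons.prems by (auto simp: principal_comb_ideal)
qed

end

context local_noetherian
begin

text \<open>This picks a basis of the vector space (I + J) / J inside I: since J contains all
  products from n, an x in I outside J has annihilator n modulo J and raises the length by exactly
  one.\<close>

lemma select_gens:
  assumes "ideal J R" "J \<subseteq> n" "\<And>x a. x \<in> n \<Longrightarrow> a \<in> n \<Longrightarrow> x \<otimes> a \<in> J"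
    and I: "ideal I R" "I \<subseteq> n" and "qlength R (comb R \<one> I J) J = enat m"
  shows "\<exists>xs. set xs \<subseteq> I \<and> length xs = m \<and> gens R xs J = comb R \<one> I J"
  using assms(1-3,6)
proof (induction m arbitrary: J)
  case 0
  have "comb R \<one> I J = J"
  proof (rule ccontr)
    assume "comb R \<one> I J \<noteq> J"
    then have "J \<subset> comb R \<one> I J" using comb_supset_right[OF I(1) 0(1) one_closed] by blast
    then have "1 \<le> qlength R (comb R \<one> I J) J"
      using 0(1) I by (intro qlength_pos comb_ideal) auto
    then show False using 0(4) by (simp add: one_enat_def)
  qed
  then show ?case by (intro exI[of _ "[]"]) simp
next
  case (Suc m)
  have "\<not> I \<subseteq> J"
  proof
    assume "I \<subseteq> J"
    then have "comb R \<one> I J \<subseteq> J"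
      using ideal_carrier[OF I(1)] Suc.prems by (intro comb_least) auto
    then have "comb R \<one> I J = J" using comb_supset_right[OF I(1) Suc.prems(1) one_closed] by blast
    then show False using Suc.prems(4) by (simp add: zero_enat_def)
  qed
  then obtain x where x: "x \<in> I" "x \<notin> J" by blast
  have xc: "x \<in> carrier R" and xn: "x \<in> n" using x I ideal_carrier by blast+
  let ?J = "comb R x (carrier R) J"
  have J: "ideal ?J R" and JJ: "J \<subseteq> ?J" and xJ: "x \<in> ?J"
    using Suc.prems xc by (auto simp: principal_comb_ideal principal_comb_supset principal_comb_mem)
  have Jn: "?J \<subseteq> n" using Suc.prems xn by (intro principal_comb_least) auto
  have iIJ: "ideal (comb R \<one> I J) R" using I Suc.prems by (intro comb_ideal) auto
  have sub: "?J \<subseteq> comb R \<one> I J"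
    using sum_ideal_supset_left[OF I(1) Suc.prems(1)] comb_supset_right[OF I(1) Suc.prems(1) one_closed] x iIJ
    by (intro principal_comb_least) auto
  have eq: "comb R \<one> I ?J = comb R \<one> I J"
  proof
    show "comb R \<one> I ?J \<subseteq> comb R \<one> I J"
      using sum_ideal_supset_left[OF I(1) Suc.prems(1)] ideal_carrier[OF I(1)]
      by (intro comb_least[OF iIJ sub]) auto
    show "comb R \<one> I J \<subseteq> comb R \<one> I ?J" by (intro comb_mono JJ order_refl)
  qed
  have pull: "ideal (pull R x (carrier R) J) R"
    using pull_ideal[OF oneideal Suc.prems(1) xc] .
  have "\<one> \<notin> pull R x (carrier R) J" using x xc by (simp add: pull_def)
  then have "pull R x (carrier R) J \<subseteq> n" using proper_le_n[OF pull] one_closed by blast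
  moreover have "n \<subseteq> pull R x (carrier R) J"
    using Suc.prems(3)[OF xn] ideal_subset[OF ideal_n] by (auto simp: pull_def)
  ultimately have "pull R x (carrier R) J = n" by blast
  then have "qlength R ?J J = 1"
    using qlength_comb[OF oneideal Suc.prems(1) xc] qlength_maximal[OF max_n] by simp
  then have "qlength R (comb R \<one> I J) ?J + 1 = enat (Suc m)"
    using qlength_add[OF Suc.prems(1) J iIJ JJ sub] Suc.prems(4) by simp
  then have "qlength R (comb R \<one> I ?J) ?J = enat m"
    unfolding eq by (cases "qlength R (comb R \<one> I J) ?J") (auto simp: one_enat_def)
  from Suc.IH[OF J Jn _ this] obtain xs where
    xs: "set xs \<subseteq> I" "length xs = m" "gens R xs ?J = comb R \<one> I ?J"
    using Suc.prems(3) JJ by blast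
  show ?case
    by (intro exI[of _ "x # xs"]) (use xs x eq in auto)
qed

lemma qlength_cotangent_finite: "qlength R n (n \<cdot> n) \<noteq> \<infinity>"
proof -
  obtain A where A: "A \<subseteq> carrier R" "finite A" "n = Idl A"
    using finetely_gen[OF ideal_n] by blast
  obtain xs where xs: "set xs = A" using finite_list[OF A(2)] by blast
  have nn: "ideal (n \<cdot> n) R" by (intro ideal_prod_is_ideal ideal_n)
  have nn_n: "n \<cdot> n \<subseteq> n" using ideal_prod_inter[OF ideal_n ideal_n] by blast
  have An: "A \<subseteq> n" using genideal_self[OF A(1)] A(3) by blast
  have "n \<subseteq> gens R xs (n \<cdot> n)"
    unfolding A(3)
    by (rule genideal_minimal) (use gens_ideal[of xs] gens_mem[of xs] nn xs A in auto)
  then have eq: "gens R xs (n \<cdot> n) = n"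
    using gens_least[OF ideal_n nn_n] xs An by blast
  have "qlength R (gens R xs (n \<cdot> n)) (n \<cdot> n) \<le> enat (length xs)"
    by (rule qlength_gens_le[OF ideal_n qlength_maximal[OF max_n] nn])
      (use xs A An in \<open>auto intro: ideal_prod.prod\<close>)
  then show ?thesis unfolding eq by (cases "qlength R n (n \<cdot> n)") auto
qed

text \<open>Longer chains truncate to length d, so without a chain of length d the supremum is at
  most d - 1. The chain consisting of n alone excludes d = 0, where \<open>d - 1\<close> would equal
  d.\<close>

lemma krull_dim_prime_chain:
  assumes "krull_dim R = enat d"
  shows "\<exists>P. prime_chain R P d"
proof (rule ccontr)
  assume no: "\<nexists>P. prime_chain R P d"
  have "prime_chain R (\<lambda>_. n) 0" using prime_n by (simp add: prime_chain_def)
  then have d: "d \<noteq> 0" using no by metis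
  have "krull_dim R \<le> enat (d - 1)"
    unfolding krull_dim_def
  proof (rule Sup_least)
    fix x assume "x \<in> {enat n |n. \<exists>P. (\<forall>i\<le>n. primeideal (P i) R) \<and> (\<forall>i<n. P i \<subset> P (Suc i))}"
    then obtain k P where k: "x = enat k" "prime_chain R P k" unfolding prime_chain_def by blast
    have "\<not> d \<le> k"
    proof
      assume "d \<le> k"
      then have "prime_chain R P d" using k(2) unfolding prime_chain_def by auto
      then show False using no by blast
    qed
    then show "x \<le> enat (d - 1)" using k by simp
  qed
  then show False using assms d by simp
qed

text \<open>The generators \<open>xs\<close> of \<open>X\<close> are chosen in \<open>I\<close>, so that \<open>R / X\<close> is a two-dimensional regular local
  ring with \<open>I / X\<close> contained in the square of its maximal ideal.\<close>

lemma regular_two_params: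
  assumes "krull_dim R = qlength R n (n \<cdot> n)"
    and I: "ideal I R" "I \<subseteq> n"
    and two: "qlength R n (comb R \<one> I (n \<cdot> n)) = 2"
    and y: "y \<in> n" "y \<notin> comb R \<one> I (n \<cdot> n)"
  shows "\<exists>X z. X \<subseteq> I \<and> two_params R X (comb R y (carrier R) X) n y z"
proof -
  let ?W = "comb R \<one> I (n \<cdot> n)" and ?Z = "{\<zero>}"
  have nn: "ideal (n \<cdot> n) R" by (intro ideal_prod_is_ideal ideal_n)
  have nn_n: "n \<cdot> n \<subseteq> n" using ideal_prod_inter[OF ideal_n ideal_n] by blast
  have W: "ideal ?W R" using I nn by (intro comb_ideal) auto
  have nnW: "n \<cdot> n \<subseteq> ?W" using I nn by (intro comb_supset_right) auto
  have IW: "I \<subseteq> ?W" using I nn by (intro sum_ideal_supset_left) auto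
  have Wn: "?W \<subseteq> n" using I nn_n ideal_carrier[OF I(1)] by (intro comb_least) auto
  have prod: "x \<otimes> a \<in> n \<cdot> n" if "x \<in> n" "a \<in> n" for x a using that by (rule ideal_prod.prod)
  have yc: "y \<in> carrier R" using y ideal_carrier ideal_n by blast
  obtain d where d: "qlength R n (n \<cdot> n) = enat d" using qlength_cotangent_finite by auto
  have split: "qlength R n (n \<cdot> n) = 2 + qlength R ?W (n \<cdot> n)"
    using qlength_add[OF nn W ideal_n nnW Wn] two by simp
  then obtain e where e: "qlength R ?W (n \<cdot> n) = enat e" using d by (cases "qlength R ?W (n \<cdot> n)") auto
  \<comment> \<open>The cotangent space has e dimensions coming from I and two more, to be spanned
    by y and z.\<close>
  have de: "d = e + 2" using split d e by (simp add: numeral_eq_enat)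
  obtain xs where xs: "set xs \<subseteq> I" "length xs = e" "gens R xs (n \<cdot> n) = ?W"
    using select_gens[OF nn nn_n prod I e] by blast
  let ?W2 = "comb R y (carrier R) ?W"
  have W2: "ideal ?W2 R" and WW2: "?W \<subseteq> ?W2" and yW2: "y \<in> ?W2"
    using W yc by (auto simp: principal_comb_ideal principal_comb_supset principal_comb_mem)
  have W2n: "?W2 \<subseteq> n" using Wn y by (intro principal_comb_least) auto
  have "qlength R ?W2 ?W = 1"
  proof -
    have pull: "ideal (pull R y (carrier R) ?W) R" using pull_ideal[OF oneideal W yc] .
    have "\<one> \<notin> pull R y (carrier R) ?W" using y yc by (simp add: pull_def)
    then have "pull R y (carrier R) ?W \<subseteq> n" using proper_le_n[OF pull] one_closed by blast
    moreover have "n \<subseteq> pull R y (carrier R) ?W"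
      using prod[OF y(1)] nnW ideal_subset[OF ideal_n] by (auto simp: pull_def)
    ultimately have "pull R y (carrier R) ?W = n" by blast
    then show ?thesis using qlength_comb[OF oneideal W yc] qlength_maximal[OF max_n] by simp
  qed
  then have "qlength R n ?W2 + 1 = 2"
    using qlength_add[OF W W2 ideal_n WW2 W2n] two by simp
  then have W2len: "qlength R n ?W2 = enat 1"
    by (cases "qlength R n ?W2") (auto simp: one_enat_def numeral_eq_enat)
  have nW2: "comb R \<one> n ?W2 = n"
  proof
    show "comb R \<one> n ?W2 \<subseteq> n"
      using ideal_carrier[OF ideal_n] by (intro comb_least[OF ideal_n W2n]) auto
    show "n \<subseteq> comb R \<one> n ?W2" using W2 by (intro sum_ideal_supset_left) auto
  qed
  obtain zs where zs: "set zs \<subseteq> n" "length zs = 1" "gens R zs ?W2 = n"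
    using select_gens[OF W2 W2n _ ideal_n order_refl, of 1] prod nnW WW2 nW2 W2len by fastforce
  then obtain z where zs_eq: "zs = [z]" by (auto simp: length_Suc_conv)
  have z: "z \<in> n" "z \<in> carrier R" using zs zs_eq ideal_carrier[OF ideal_n] by auto
  have all: "set (xs @ [y, z]) \<subseteq> n" "set (xs @ [y, z]) \<subseteq> carrier R"
    using xs I y z yc ideal_carrier[OF I(1)] by auto
  have gen: "gens R (xs @ [y, z]) (n \<cdot> n) = n"
    using xs zs zs_eq by (simp add: gens_append)
  have iZ: "ideal ?Z R" by (rule zeroideal)
  have iG: "ideal (gens R (xs @ [y, z]) ?Z) R" using all(2) iZ by (rule gens_ideal)
  \<comment> \<open>A basis of n / n^2 generates n itself, now over the zero ideal.\<close>
  have nG: "n = gens R (xs @ [y, z]) ?Z"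
  proof (rule nakayama_square[OF iG])
    show "gens R (xs @ [y, z]) ?Z \<subseteq> n"
      using all(1) ideal_zero[OF ideal_n] by (intro gens_least) auto
    have "gens R (xs @ [y, z]) (n \<cdot> n) \<subseteq> comb R \<one> (n \<cdot> n) (gens R (xs @ [y, z]) ?Z)"
    proof (rule gens_least)
      show "ideal (comb R \<one> (n \<cdot> n) (gens R (xs @ [y, z]) ?Z)) R" using nn iG by (simp add: comb_ideal)
      show "n \<cdot> n \<subseteq> comb R \<one> (n \<cdot> n) (gens R (xs @ [y, z]) ?Z)"
        using nn iG by (rule sum_ideal_supset_left)
      show "set (xs @ [y, z]) \<subseteq> comb R \<one> (n \<cdot> n) (gens R (xs @ [y, z]) ?Z)"
        using gens_mem[OF all(2) iZ] comb_supset_right[OF nn iG one_closed] by blast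
    qed
    then show "n \<subseteq> comb R \<one> (n \<cdot> n) (gens R (xs @ [y, z]) ?Z)" unfolding gen .
  qed
  obtain P where "prime_chain R P d" using krull_dim_prime_chain assms(1) d by auto
  then have P: "prime_chain R P (length (xs @ [y, z]))" using de xs by simp
  have Z: "?Z \<subseteq> P 0"
    using P ideal_zero primeideal_ideal by (fastforce simp: prime_chain_def)
  define X where "X = gens R xs ?Z"
  define Y where "Y = comb R y (carrier R) X"
  \<comment> \<open>The list of d generators is split after \<open>xs\<close> to make X prime, and
    then after y to make Y prime.\<close>
  have "\<exists>Q. prime_chain R Q 2 \<and> X = Q 0"
    using prime_chain_gens[of xs "[y, z]" ?Z P] nG iZ all P Z unfolding X_def by (simp add: numeral_2_eq_2)
  then have X: "primeideal X R" by (auto simp: prime_chain_def)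
  have "\<exists>Q. prime_chain R Q 1 \<and> gens R (xs @ [y]) ?Z = Q 0"
    using prime_chain_gens[of "xs @ [y]" "[z]" ?Z P] nG iZ all P Z by simp
  moreover have "gens R (xs @ [y]) ?Z = Y" by (simp add: X_def Y_def gens_append)
  ultimately have Y: "primeideal Y R" by (auto simp: prime_chain_def)
  have nz: "n = comb R z (carrier R) Y" using nG by (simp add: X_def Y_def gens_append)
  have XI: "X \<subseteq> I" unfolding X_def using xs ideal_zero[OF I(1)] I by (intro gens_least) auto
  have yX: "y \<notin> X" using y XI IW by blast
  have zY: "z \<notin> Y"
  proof
    assume "z \<in> Y"
    then have "n \<subseteq> Y"
      unfolding nz using principal_comb_least[OF primeideal_ideal[OF Y] order_refl] by blast
    moreover have "Y \<subseteq> ?W2" unfolding Y_def using XI IW by (intro comb_mono) auto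
    ultimately have "n = ?W2" using W2n by blast
    then show False using W2len by (simp add: zero_enat_def)
  qed
  have "two_params R X Y n y z"
    by (intro two_params.intro two_params_axioms.intro is_cring X Y max_n yc z(2) Y_def nz yX zY)
  then show ?thesis using XI Y_def by blast
qed

end

section \<open>Length bounds in terms of the type\<close>

context two_params_ideal
begin

lemma y_in_n: "y \<in> n" and z_in_n: "z \<in> n"
  using y_in_Y[of \<one>] Y_n principal_comb_mem[OF z ideal_Y] n_eq by auto

lemma n_cases:
  assumes "a \<in> n"
  obtains d c x where "d \<in> carrier R" "c \<in> carrier R" "x \<in> X" "a = z \<otimes> d \<oplus> (y \<otimes> c \<oplus> x)"
proof -
  obtain d u where du: "d \<in> carrier R" "u \<in> Y" "a = z \<otimes> d \<oplus> u"
    using assms unfolding n_eq by (rule combE)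
  obtain c x where "c \<in> carrier R" "x \<in> X" "u = y \<otimes> c \<oplus> x"
    using du(2) unfolding Y_eq by (rule combE)
  then show thesis using du that by blast
qed

text \<open>X lies in I, so only the generators y and z of n modulo X matter: (I : n) / I is the
  kernel of z on (I : y) / I.\<close>

lemma colon_n_eq: "colon_ideal R I n = pull R z colon_y I"
proof
  show "colon_ideal R I n \<subseteq> pull R z colon_y I"
    using y_in_n z_in_n by (auto simp: colon_ideal_def pull_def colon_y_def m_comm)
  show "pull R z colon_y I \<subseteq> colon_ideal R I n"
  proof
    fix f assume f: "f \<in> pull R z colon_y I"
    then have fI: "f \<in> carrier R" "y \<otimes> f \<in> I" "z \<otimes> f \<in> I"
      by (auto simp: pull_def colon_y_def)
    have "f \<otimes> a \<in> I" if a: "a \<in> n" for a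
    proof -
      obtain d c x where *: "d \<in> carrier R" "c \<in> carrier R" "x \<in> X" "a = z \<otimes> d \<oplus> (y \<otimes> c \<oplus> x)"
        using a by (rule n_cases)
      have xc: "x \<in> carrier R" using * ideal_carrier[OF ideal_X] by blast
      have "f \<otimes> a = d \<otimes> (z \<otimes> f) \<oplus> (c \<otimes> (y \<otimes> f) \<oplus> f \<otimes> x)"
        unfolding *(4) using fI(1) *(1,2) xc y z by algebra
      also have "\<dots> \<in> I"
        using ideal_lmult[OF ideal_I fI(3) *(1)] ideal_lmult[OF ideal_I fI(2) *(2)]
          ideal_lmult[OF ideal_I _ fI(1), of x] *(3) X_I
        by (intro ideal_add[OF ideal_I]) auto
      finally show ?thesis .
    qed
    then show "f \<in> colon_ideal R I n" using fI by (simp add: colon_ideal_def)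
  qed
qed

lemma nI_pw: "n \<cdot> I \<subseteq> pw 1"
proof
  fix s assume "s \<in> n \<cdot> I"
  then show "s \<in> pw 1"
  proof (induction s rule: ideal_prod.induct)
    case (prod a f)
    obtain d c x where *: "d \<in> carrier R" "c \<in> carrier R" "x \<in> X" "a = z \<otimes> d \<oplus> (y \<otimes> c \<oplus> x)"
      using prod(1) by (rule n_cases)
    have cl: "x \<in> carrier R" "f \<in> carrier R" using * prod I_carrier ideal_carrier[OF ideal_X] by blast+
    have "a \<otimes> f = d \<otimes> (z \<otimes> f) \<oplus> (c \<otimes> (y \<otimes> f) \<oplus> f \<otimes> x)"
      unfolding *(4) using *(1,2) cl y z by algebra
    also have "\<dots> \<in> pw 1"
      using ideal_lmult[OF ideal_pw _ *(1), of "z \<otimes> f" 1] ideal_lmult[OF ideal_pw _ *(2), of "y \<otimes> f" 1]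
        ideal_lmult[OF ideal_pw _ cl(2), of x 1] *(3) prod(2) X_pw[of 1] yI_pw[of f 1] z_pw[of f 0] pw_0
      by (intro ideal_add[OF ideal_pw]) auto
    finally show ?case .
  next
    case (sum s t)
    then show ?case by (intro ideal_add[OF ideal_pw])
  qed
qed

context
  fixes r l
  assumes length_I: "qlength R (carrier R) I = enat l"
    and type_I: "qlength R (colon_ideal R I n) I = enat r"
begin

text \<open>By \<open>nI_pw\<close>, yJ lies in zI + yI + X, and \<open>pull_y_pwM\<close> for i = 0
  cancels y to put J into I + z(I : y). The counts for i = 1 then give 2r(r + 1) \<le> 2l.\<close>

lemma length_bound_two:
  assumes "\<And>f. f \<in> colon_ideal R I n \<Longrightarrow> y \<otimes> f \<in> n \<cdot> I"
  shows "r * (r + 1) \<le> l"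
proof -
  have fin: "qlength R (carrier R) I \<noteq> \<infinity>" using length_I by simp
  have "pull R z colon_y I \<subseteq> pwM 1"
  proof
    fix f assume f: "f \<in> pull R z colon_y I"
    then have fc: "f \<in> colon_y" by (simp add: pull_def)
    have "f \<in> pwM 0" using zpwM[OF fc, of 0] colon_carrier[OF fc] by simp
    moreover have "y \<otimes> f \<in> pw (Suc 0)"
      using assms[of f] f nI_pw colon_n_eq by auto
    ultimately show "f \<in> pwM 1" using pull_y_pwM[of 0] by (auto simp: pull_def)
  qed
  from socle_length_le[OF fin this]
  have "enat (Suc r) \<le> qlength R (pw 1) (pw (Suc 1))"
    using type_I colon_n_eq by (simp add: one_enat_def)
  from length_ge_triangle[OF ideal_I X_I fin this]
  show ?thesis using length_I by (simp add: numeral_eq_enat)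
qed

text \<open>Here zJ + yJ + X is contained in zI + yI + X, so J needs at least r generators for J / I
  and r + 1 for I / (zI + yI + X). The triangular bound gives J colength at least r(2r + 1), and J /
  I adds r.\<close>

lemma length_bound_one:
  assumes sub: "\<And>a f. a \<in> n \<Longrightarrow> f \<in> colon_ideal R I n \<Longrightarrow> a \<otimes> f \<in> n \<cdot> I"
  shows "2 * r * (r + 1) \<le> l"
proof -
  let ?J = "colon_ideal R I n"
  have J: "ideal ?J R" and IJ: "I \<subseteq> ?J"
    using I_socle unfolding colon_n_eq by simp_all
  interpret J: two_params_ideal R X Y n y z ?J
    by (intro two_params_ideal.intro two_params_ideal_axioms.intro two_params_axioms J)
      (use X_I IJ in blast)
  have fin: "qlength R (carrier R) I \<noteq> \<infinity>" using length_I by simp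
  have "pull R z colon_y I \<subseteq> pwM 0"
    using zpwM[of _ 0] colon_carrier by (fastforce simp: pull_def)
  from socle_length_le[OF fin this]
  have top: "enat (Suc r) \<le> qlength R I (pw 1)"
    using type_I colon_n_eq pw_0 by (simp add: one_enat_def)
  have JJ: "J.pw 1 \<subseteq> pw 1"
  proof (rule J.pw_least)
    show "y \<otimes> f \<in> pw 1" if "f \<in> ?J" for f using sub[OF y_in_n that] nI_pw by blast
    show "z [^] (1::nat) \<otimes> f \<in> pw 1" if "f \<in> ?J" for f using sub[OF z_in_n that] nI_pw z by auto
  qed (use X_pw in auto)
  have "enat (Suc (2 * r)) = enat r + enat (Suc r)" by simp
  also have "\<dots> \<le> qlength R ?J I + qlength R I (pw 1)"
    unfolding type_I using top by (rule add_left_mono)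
  also have "\<dots> = qlength R ?J (pw 1)"
    by (rule qlength_add[symmetric]) (use pw_le_I IJ J in auto)
  also have "\<dots> \<le> qlength R ?J (J.pw 1)"
    by (rule qlength_antimono) (use JJ pw_le_I IJ J in auto)
  finally have "enat (Suc (2 * r)) \<le> qlength R (J.pw 0) (J.pw (Suc 0))"
    using J.pw_0 by simp
  moreover have sum: "qlength R (carrier R) I = qlength R (carrier R) ?J + enat r"
    using qlength_add[OF ideal_I J oneideal IJ ideal_subset[OF J]] type_I by simp
  moreover obtain j where j: "qlength R (carrier R) ?J = enat j"
    using sum length_I by (cases "qlength R (carrier R) ?J") auto
  ultimately have "enat (Suc 0 * (2 * r * Suc (2 * r))) \<le> 2 * enat j"
    using length_ge_triangle[OF J J.X_I, of "2 * r" 0] by simp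
  then have "r * Suc (2 * r) \<le> j" by (simp add: numeral_eq_enat)
  moreover have "l = j + r" using sum length_I j by simp
  ultimately show ?thesis by (simp add: algebra_simps)
qed

end

end

section \<open>The ideal nI : (I : n)\<close>

context cring
begin

lemma colon_ideal_ideal:
  assumes J: "ideal J R" and K: "K \<subseteq> carrier R"
  shows "ideal (colon_ideal R J K) R"
proof (rule idealI')
  show "colon_ideal R J K \<subseteq> carrier R" by (auto simp: colon_ideal_def)
  show "\<zero> \<in> colon_ideal R J K" using K ideal_zero[OF J] by (auto simp: colon_ideal_def)
  show "a \<oplus> b \<in> colon_ideal R J K" if "a \<in> colon_ideal R J K" "b \<in> colon_ideal R J K" for a b
    using that K ideal_add[OF J] by (auto simp: colon_ideal_def l_distr subset_iff)
  show "x \<otimes> a \<in> colon_ideal R J K" if "a \<in> colon_ideal R J K" "x \<in> carrier R" for a x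
    using that K ideal_lmult[OF J] by (auto simp: colon_ideal_def m_assoc subset_iff)
qed

end

text \<open>For r > 0 the ideal C lies between W = I + n^2 and n, an interval of length two. So the
  index is positive iff C differs from n, and equals 2 iff C = W; an element of C outside W is a
  parameter y with yJ \<subseteq> nI.\<close>

lemma (in local_noetherian) burch_bounds:
  assumes dim: "krull_dim R = qlength R n (n \<cdot> n)"
    and I: "ideal I R" "I \<subseteq> n"
    and two: "qlength R n (comb R \<one> I (n \<cdot> n)) = 2"
    and len: "qlength R (carrier R) I = enat l"
    and type: "qlength R (colon_ideal R I n) I = enat r"
  defines "C \<equiv> colon_ideal R (n \<cdot> I) (colon_ideal R I n)"
  shows "l < 2 * r * (r + 1) \<Longrightarrow> 1 \<le> qlength R n C"
    and "l < r * (r + 1) \<Longrightarrow> qlength R n C = 2"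
proof -
  let ?W = "comb R \<one> I (n \<cdot> n)" and ?J = "colon_ideal R I n"
  have nI: "ideal (n \<cdot> I) R" using I by (intro ideal_prod_is_ideal ideal_n)
  have nn: "ideal (n \<cdot> n) R" by (intro ideal_prod_is_ideal ideal_n)
  have W: "ideal ?W R" using I nn by (intro comb_ideal) auto
  have nn_n: "n \<cdot> n \<subseteq> n" using ideal_prod_inter[OF ideal_n ideal_n] by blast
  have Wn: "?W \<subseteq> n" using I nn_n ideal_carrier[OF I(1)] by (intro comb_least) auto
  have IW: "I \<subseteq> ?W" using I nn by (intro sum_ideal_supset_left) auto
  have J: "ideal ?J R" using I ideal_subset[OF ideal_n] by (intro colon_ideal_ideal)
  have C: "ideal C R" unfolding C_def using nI ideal_subset[OF J] by (intro colon_ideal_ideal)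
  have "I \<noteq> n"
  proof
    assume "I = n"
    then have "?W = n" using IW Wn by blast
    then show False using two by simp
  qed
  have "?J \<noteq> carrier R"
  proof
    assume "?J = carrier R"
    then have "\<one> \<in> ?J" by simp
    then have "n \<subseteq> I" using ideal_carrier[OF ideal_n] by (fastforce simp: colon_ideal_def)
    then show False using \<open>I \<noteq> n\<close> I by blast
  qed
  then have Jn: "?J \<subseteq> n" using proper_le_n[OF J] by blast
  have Jc: "f \<in> carrier R" if "f \<in> ?J" for f using that by (simp add: colon_ideal_def)
  have Jmult: "f \<otimes> a \<in> I" if "f \<in> ?J" "a \<in> n" for f a using that by (simp add: colon_ideal_def)
  have Cmult: "c \<otimes> f \<in> n \<cdot> I" if "c \<in> C" "f \<in> ?J" for c f
    using that unfolding C_def colon_ideal_def[of R "n \<cdot> I"] by blast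
  have IJ: "I \<subseteq> ?J"
    using I ideal_carrier[OF ideal_n] by (auto simp: colon_ideal_def intro: ideal_rmult)
  have IC: "I \<subseteq> C"
  proof
    fix a assume a: "a \<in> I"
    have "a \<otimes> f \<in> n \<cdot> I" if "f \<in> ?J" for f
      using ideal_prod.prod[of f n a I R] that Jn a Jc[OF that] ideal_carrier[OF I(1) a] by (auto simp: m_comm)
    then show "a \<in> C" using a ideal_carrier[OF I(1)] by (simp add: C_def colon_ideal_def)
  qed
  have nnC: "n \<cdot> n \<subseteq> C"
  proof
    fix s assume "s \<in> n \<cdot> n"
    then show "s \<in> C"
    proof (induction s rule: ideal_prod.induct)
      case (prod a b)
      have ab: "a \<in> carrier R" "b \<in> carrier R" using prod ideal_carrier[OF ideal_n] by auto
      have "a \<otimes> b \<otimes> f \<in> n \<cdot> I" if f: "f \<in> ?J" for f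
      proof -
        have "a \<otimes> (f \<otimes> b) \<in> n \<cdot> I" using prod Jmult[OF f] by (intro ideal_prod.prod)
        moreover have "a \<otimes> b \<otimes> f = a \<otimes> (f \<otimes> b)" using ab Jc[OF f] by (simp add: m_ac)
        ultimately show ?thesis by simp
      qed
      then show ?case using ab by (simp add: C_def colon_ideal_def)
    next
      case (sum s t)
      then show ?case by (intro ideal_add[OF C])
    qed
  qed
  have WC: "?W \<subseteq> C" using IC nnC ideal_carrier[OF I(1)] by (intro comb_least[OF C]) auto
  have Cn: "C \<subseteq> n" if "r \<noteq> 0"
  proof -
    have "C \<noteq> carrier R"
    proof
      assume "C = carrier R"
      then have "\<one> \<in> C" by simp
      have "f \<in> n \<cdot> I" if "f \<in> ?J" for f
        using Cmult[OF \<open>\<one> \<in> C\<close> that] Jc[OF that] by simp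
      then have "?J = I"
        using IJ ideal_prod_inter[OF ideal_n I(1)] by blast
      then show False using type that by (simp add: zero_enat_def)
    qed
    then show ?thesis using proper_le_n[OF C] by blast
  qed
  have params: "\<exists>X z. X \<subseteq> I \<and> two_params R X (comb R y (carrier R) X) n y z"
    if "y \<in> n" "y \<notin> ?W" for y
    using regular_two_params[OF dim I two that] .
  show "1 \<le> qlength R n C" if small: "l < 2 * r * (r + 1)"
  proof -
    have "C \<noteq> n"
    proof
      assume eq: "C = n"
      have "?W \<noteq> n" using two by auto
      \<comment> \<open>Any y outside \<open>?W\<close> serves, because all of n now multiplies I :
        n into nI.\<close>
      then obtain y where "y \<in> n" "y \<notin> ?W" using Wn by blast
      then obtain X z where X: "X \<subseteq> I" and "two_params R X (comb R y (carrier R) X) n y z"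
        using params by blast
      then interpret two_params_ideal R X "comb R y (carrier R) X" n y z I
        using I by (intro two_params_ideal.intro two_params_ideal_axioms.intro)
      have "2 * r * (r + 1) \<le> l"
        by (rule length_bound_one[OF len type]) (use eq Cmult in blast)
      then show False using small by simp
    qed
    moreover have "r \<noteq> 0" using small by (cases r) auto
    ultimately show ?thesis using Cn C by (intro qlength_pos) auto
  qed
  show "qlength R n C = 2" if small: "l < r * (r + 1)"
  proof -
    have "C \<subseteq> ?W"
    proof
      fix y assume yC: "y \<in> C"
      show "y \<in> ?W"
      proof (rule ccontr)
        assume "y \<notin> ?W"
        moreover have "r \<noteq> 0" using small by (cases r) auto
        ultimately obtain X z where X: "X \<subseteq> I" and "two_params R X (comb R y (carrier R) X) n y z"
          using params yC Cn by blast
        then interpret two_params_ideal R X "comb R y (carrier R) X" n y z I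
          using I by (intro two_params_ideal.intro two_params_ideal_axioms.intro)
        have "r * (r + 1) \<le> l"
          by (rule length_bound_two[OF len type]) (use yC Cmult in blast)
        then show False using small by simp
      qed
    qed
    then have "C = ?W" using WC by blast
    then show ?thesis using two by simp
  qed
qed

section \<open>Transfer along a surjective ring homomorphism\<close>

locale surjective_ring_hom = ring_hom_cring R S h
  for R (structure) and S (structure) and h +
  assumes surj: "h ` carrier R = carrier S"
begin

definition "vim L = {r \<in> carrier R. h r \<in> L}"

lemma hom_ring_hom: "ring_hom_ring R S h"
  using R.ring_axioms S.ring_axioms homh by (rule ring_hom_ringI2)

lemma vim_ideal: "ideal L S \<Longrightarrow> ideal (vim L) R"
  unfolding vim_def by (rule ring_hom_ring.ideal_vimage[OF hom_ring_hom])

lemma img_ideal: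
  assumes K: "ideal K R"
  shows "ideal (h ` K) S"
proof (rule S.idealI')
  show "h ` K \<subseteq> carrier S" using R.ideal_carrier[OF K] by auto
  show "\<zero>\<^bsub>S\<^esub> \<in> h ` K" using R.ideal_zero[OF K] hom_zero by force
  show "a \<oplus>\<^bsub>S\<^esub> b \<in> h ` K" if ab: "a \<in> h ` K" "b \<in> h ` K" for a b
  proof -
    obtain u v where "u \<in> K" "v \<in> K" "a = h u" "b = h v" using ab by blast
    then show ?thesis using R.ideal_add[OF K] R.ideal_carrier[OF K] by (auto intro!: image_eqI[of _ _ "u \<oplus> v"])
  qed
  show "x \<otimes>\<^bsub>S\<^esub> a \<in> h ` K" if a: "a \<in> h ` K" and x: "x \<in> carrier S" for a x
  proof -
    obtain u v where "u \<in> K" "v \<in> carrier R" "a = h u" "x = h v" using a x surj by blast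
    then show ?thesis using R.ideal_lmult[OF K] R.ideal_carrier[OF K] by (auto intro!: image_eqI[of _ _ "v \<otimes> u"])
  qed
qed

lemma img_vim:
  assumes "L \<subseteq> carrier S"
  shows "h ` vim L = L"
proof
  show "h ` vim L \<subseteq> L" by (auto simp: vim_def)
  show "L \<subseteq> h ` vim L"
  proof
    fix b assume b: "b \<in> L"
    then obtain a where "a \<in> carrier R" "b = h a" using assms surj by blast
    then show "b \<in> h ` vim L" using b by (simp add: vim_def)
  qed
qed

lemma vim_img:
  assumes K: "ideal K R" and ker: "vim {\<zero>\<^bsub>S\<^esub>} \<subseteq> K"
  shows "vim (h ` K) = K"
proof
  show "K \<subseteq> vim (h ` K)" using R.ideal_carrier[OF K] by (auto simp: vim_def)
  show "vim (h ` K) \<subseteq> K"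
  proof
    fix a assume "a \<in> vim (h ` K)"
    then obtain k where k: "a \<in> carrier R" "k \<in> K" "h a = h k" by (auto simp: vim_def)
    have kc: "k \<in> carrier R" using k R.ideal_carrier[OF K] by blast
    have "h (a \<ominus> k) = \<zero>\<^bsub>S\<^esub>" using k kc by (simp add: R.minus_eq S.r_neg)
    then have "a \<ominus> k \<in> K" using ker k kc by (auto simp: vim_def)
    then have "k \<oplus> (a \<ominus> k) \<in> K" using K k by (intro R.ideal_add)
    moreover have "k \<oplus> (a \<ominus> k) = a" using k(1) kc by algebra
    ultimately show "a \<in> K" by simp
  qed
qed

text \<open>Correspondence theorem: preimage and image are mutually inverse between the ideals of S
  and the ideals of R above the kernel, and both preserve strict inclusion.\<close>

lemma qlength_vim:
  assumes K: "ideal K S" and J: "ideal J S" 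
  shows "qlength S K J = qlength R (vim K) (vim J)"
proof (rule antisym)
  show "qlength S K J \<le> qlength R (vim K) (vim J)"
  proof (rule qlength_mono_map[where g = vim])
    fix L M assume LM: "ideal L S" "ideal M S" "L \<subset> M"
    have "vim L \<subseteq> vim M" using LM(3) unfolding vim_def by blast
    moreover have "vim L \<noteq> vim M"
      using img_vim[OF S.ideal_subset[OF LM(1)]] img_vim[OF S.ideal_subset[OF LM(2)]] LM(3)
      by (metis psubset_eq)
    ultimately show "vim L \<subset> vim M" by blast
  qed (auto intro: vim_ideal)
  show "qlength R (vim K) (vim J) \<le> qlength S K J"
  proof (rule qlength_mono_map[where g = "\<lambda>L. h ` L"])
    have ker: "vim {\<zero>\<^bsub>S\<^esub>} \<subseteq> vim J" using S.ideal_zero[OF J] by (auto simp: vim_def)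
    fix L M assume LM: "ideal L R" "ideal M R" "vim J \<subseteq> L" "L \<subset> M"
    then have "vim (h ` L) = L" "vim (h ` M) = M" using ker by (auto intro!: vim_img)
    then show "h ` L \<subset> h ` M" using LM(4) by (metis image_mono psubset_eq)
  qed (use S.ideal_subset K J in \<open>auto intro: img_ideal simp: img_vim\<close>)
qed

lemma vim_carrier: "vim (carrier S) = carrier R"
  unfolding vim_def by auto

lemma vim_maximal:
  assumes "maximalideal m S"
  shows "maximalideal (vim m) R"
proof (rule maximalidealI)
  have m: "ideal m S" using assms by (simp add: maximalideal_def)
  show "ideal (vim m) R" using m by (rule vim_ideal)
  have "\<one>\<^bsub>S\<^esub> \<notin> m"
    using ideal.one_imp_carrier[OF m] maximalideal.I_notcarr[OF assms] by auto
  then show "carrier R \<noteq> vim m" by (auto simp: vim_def set_eq_iff intro!: exI[of _ \<one>])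
  fix K assume K: "ideal K R" "vim m \<subseteq> K"
  have mK: "m \<subseteq> h ` K" using img_vim[OF S.ideal_subset[OF m]] K(2) by blast
  have "vim {\<zero>\<^bsub>S\<^esub>} \<subseteq> K" using K(2) S.ideal_zero[OF m] by (auto simp: vim_def)
  then have "vim (h ` K) = K" using K by (intro vim_img)
  moreover have "h ` K = m \<or> h ` K = carrier S"
    using maximalideal.I_maximal[OF assms img_ideal[OF K(1)] mK] S.ideal_subset[OF img_ideal[OF K(1)]] by blast
  ultimately show "K = vim m \<or> K = carrier R" using vim_carrier by auto
qed

lemma vim_colon_zero:
  assumes "ideal m S"
  shows "vim (colon_ideal S {\<zero>\<^bsub>S\<^esub>} m) = colon_ideal R (vim {\<zero>\<^bsub>S\<^esub>}) (vim m)"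
proof -
  have "(\<forall>y\<in>m. h r \<otimes>\<^bsub>S\<^esub> y \<in> {\<zero>\<^bsub>S\<^esub>}) \<longleftrightarrow> (\<forall>t\<in>vim m. r \<otimes> t \<in> vim {\<zero>\<^bsub>S\<^esub>})"
    if r: "r \<in> carrier R" for r
  proof -
    have "(\<forall>y\<in>h ` vim m. h r \<otimes>\<^bsub>S\<^esub> y \<in> {\<zero>\<^bsub>S\<^esub>}) \<longleftrightarrow> (\<forall>t\<in>vim m. r \<otimes> t \<in> vim {\<zero>\<^bsub>S\<^esub>})"
      using r by (auto simp: vim_def)
    then show ?thesis unfolding img_vim[OF S.ideal_subset[OF assms]] .
  qed
  then show ?thesis
    unfolding colon_ideal_def vim_def[of "{a \<in> _. _ a}"] by auto
qed

text \<open>Products lift only up to the kernel, whence the extra summand. It turns the embedding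
  dimension of the quotient into the length of n / (I + n^2).\<close>

lemma vim_prod:
  assumes m: "ideal m S"
  shows "vim (m \<cdot>\<^bsub>S\<^esub> m) = comb R \<one> (vim {\<zero>\<^bsub>S\<^esub>}) (vim m \<cdot> vim m)"
proof
  let ?n = "vim m"
  have n: "ideal ?n R" using m by (rule vim_ideal)
  have mm: "ideal (m \<cdot>\<^bsub>S\<^esub> m) S" using m m by (rule S.ideal_prod_is_ideal)
  have nn: "ideal (?n \<cdot> ?n) R" using n n by (rule R.ideal_prod_is_ideal)
  have ker: "ideal (vim {\<zero>\<^bsub>S\<^esub>}) R" using S.zeroideal by (rule vim_ideal)
  show "vim (m \<cdot>\<^bsub>S\<^esub> m) \<subseteq> comb R \<one> (vim {\<zero>\<^bsub>S\<^esub>}) (?n \<cdot> ?n)"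
  proof -
    let ?K = "comb R \<one> (vim {\<zero>\<^bsub>S\<^esub>}) (?n \<cdot> ?n)"
    have K: "ideal ?K R" using ker nn by (simp add: R.comb_ideal)
    have nnK: "?n \<cdot> ?n \<subseteq> ?K" using ker nn by (simp add: R.comb_supset_right)
    have "m \<cdot>\<^bsub>S\<^esub> m \<subseteq> h ` ?K"
    proof
      fix s assume "s \<in> m \<cdot>\<^bsub>S\<^esub> m"
      then show "s \<in> h ` ?K"
      proof (induction s rule: ideal_prod.induct)
        case (prod i j)
        then obtain a b where ab: "a \<in> ?n" "b \<in> ?n" "i = h a" "j = h b"
          using img_vim[OF S.ideal_subset[OF m]] by (metis imageE)
        then have "a \<otimes> b \<in> ?K" using nnK ideal_prod.prod[of a ?n b ?n R] by blast
        moreover have "h (a \<otimes> b) = i \<otimes>\<^bsub>S\<^esub> j" using ab by (simp add: vim_def)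
        ultimately show ?case by (metis imageI)
      next
        case (sum s t)
        then show ?case using S.ideal_add[OF img_ideal[OF K]] by blast
      qed
    qed
    then have "vim (m \<cdot>\<^bsub>S\<^esub> m) \<subseteq> vim (h ` ?K)" by (auto simp: vim_def)
    also have "\<dots> = ?K" using ker nn by (intro vim_img[OF K]) (rule R.sum_ideal_supset_left)
    finally show ?thesis .
  qed
  show "comb R \<one> (vim {\<zero>\<^bsub>S\<^esub>}) (?n \<cdot> ?n) \<subseteq> vim (m \<cdot>\<^bsub>S\<^esub> m)"
  proof (rule R.comb_least[OF vim_ideal[OF mm]])
    show "?n \<cdot> ?n \<subseteq> vim (m \<cdot>\<^bsub>S\<^esub> m)"
    proof
      fix s assume "s \<in> ?n \<cdot> ?n"
      then show "s \<in> vim (m \<cdot>\<^bsub>S\<^esub> m)"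
      proof (induction s rule: ideal_prod.induct)
        case (prod a b)
        then show ?case by (auto simp: vim_def intro: ideal_prod.prod)
      next
        case (sum s t)
        then show ?case by (intro R.ideal_add[OF vim_ideal[OF mm]])
      qed
    qed
    show "\<one> \<otimes> k \<in> vim (m \<cdot>\<^bsub>S\<^esub> m)" if "k \<in> vim {\<zero>\<^bsub>S\<^esub>}" for k
      using that S.ideal_zero[OF mm] by (auto simp: vim_def)
  qed
qed

end

section \<open>Application to the presentation S / I\<close>

lemma local_ring_max_ideal:
  assumes "local_ring R"
  shows "maximalideal (max_ideal R) R" "maximalideal m R \<Longrightarrow> m = max_ideal R"
proof -
  have ex: "\<exists>!m. maximalideal m R" using assms by (simp add: local_ring_def)
  show "maximalideal (max_ideal R) R" unfolding max_ideal_def by (rule theI'[OF ex])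
  show "m = max_ideal R" if "maximalideal m R"
    unfolding max_ideal_def by (rule the1_equality[OF ex that, symmetric])
qed

text \<open>Inverting the isomorphism lets it be composed with the projection from S to S / I, so
  that ideals of R can be pulled back to S.\<close>

lemma quotient_iso_surjective_hom:
  assumes R: "cring R" and S: "cring S" and I: "ideal I S" and phi: "\<phi> \<in> ring_iso R (S Quot I)"
  shows "\<exists>h. surjective_ring_hom S R h \<and> {s \<in> carrier S. h s = \<zero>\<^bsub>R\<^esub>} = I"
proof -
  interpret R: cring R by (rule R)
  interpret S: cring S by (rule S)
  interpret I: ideal I S by (rule I)
  interpret Q: ring "S Quot I" by (rule I.quotient_is_ring)
  define \<psi> where "\<psi> = inv_into (carrier R) \<phi>"
  define h where "h = \<psi> \<circ> (+>\<^bsub>S\<^esub>) I"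
  have psi: "\<psi> \<in> ring_iso (S Quot I) R"
    unfolding \<psi>_def using R.ring_axioms phi by (rule ring_iso_set_sym)
  have carrier_Q: "carrier (S Quot I) = (+>\<^bsub>S\<^esub>) I ` carrier S"
    unfolding FactRing_def A_RCOSETS_def' by auto
  have "h \<in> ring_hom S R"
    unfolding h_def using I.rcos_ring_hom psi by (intro ring_hom_trans) (auto simp: ring_iso_def)
  moreover have "h ` carrier S = carrier R"
    unfolding h_def image_comp[symmetric] carrier_Q[symmetric]
    using psi by (auto simp: ring_iso_def bij_betw_def)
  ultimately have hom: "surjective_ring_hom S R h"
    using S R by (simp add: surjective_ring_hom_def surjective_ring_hom_axioms_def
        ring_hom_cring_def ring_hom_cring_axioms_def)
  have "h s = \<zero>\<^bsub>R\<^esub> \<longleftrightarrow> s \<in> I" if s: "s \<in> carrier S" for s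
  proof -
    have inj: "inj_on \<psi> (carrier (S Quot I))" using psi by (simp add: ring_iso_def bij_betw_def)
    have "\<psi> \<in> ring_hom (S Quot I) R" using psi by (simp add: ring_iso_def)
    then have "\<psi> \<zero>\<^bsub>S Quot I\<^esub> = \<zero>\<^bsub>R\<^esub>"
      using Q.ring_axioms R.ring_axioms by (rule ring_hom_zero)
    then have "\<psi> I = \<zero>\<^bsub>R\<^esub>" by (simp add: FactRing_def)
    moreover have "I \<in> carrier (S Quot I)"
      using Q.zero_closed by (simp add: FactRing_def)
    moreover have "I +>\<^bsub>S\<^esub> s \<in> carrier (S Quot I)"
      unfolding carrier_Q using s by (rule imageI)
    ultimately have "h s = \<zero>\<^bsub>R\<^esub> \<longleftrightarrow> I +>\<^bsub>S\<^esub> s = I"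
      unfolding h_def using inj by (metis comp_apply inj_on_eq_iff)
    also have "\<dots> \<longleftrightarrow> s \<in> I"
      using I.rcos_const_imp_mem[OF s] S.a_rcos_zero[OF I] by blast
    finally show ?thesis .
  qed
  then have "{s \<in> carrier S. h s = \<zero>\<^bsub>R\<^esub>} = I" using I.Icarr by auto
  then show ?thesis using hom by blast
qed

theorem theorem4p7:
  fixes R :: "('a, 'c) ring_scheme" and S :: "('b, 'd) ring_scheme" and I :: "'b set"
    and \<phi> :: "'a \<Rightarrow> 'b set"
  assumes "local_ring R" and "artinian_ring R" and "edim R = 2"
    and "regular_local_ring S" and "ideal I S" and "\<phi> \<in> ring_iso R (S Quot I)"
  shows "(ring_length R < 2 * ring_type R * (ring_type R + 1) \<longrightarrow> burch_of_presentation S I \<ge> 1)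
       \<and> (ring_length R < ring_type R * (ring_type R + 1) \<longrightarrow> burch_of_presentation S I = 2)"
proof -
  have S: "local_ring S" "noetherian_ring S" "krull_dim S = edim S"
    using assms(4) by (auto simp: regular_local_ring_def)
  have cr: "cring R" "cring S" using assms(1) S(1) by (auto simp: local_ring_def)
  let ?n = "max_ideal S" and ?m = "max_ideal R"
  obtain h where h: "surjective_ring_hom S R h" and ker: "{s \<in> carrier S. h s = \<zero>\<^bsub>R\<^esub>} = I"
    using quotient_iso_surjective_hom[OF cr assms(5,6)] by blast
  interpret h: surjective_ring_hom S R h by (rule h)
  interpret L: local_noetherian S ?n
    using cr S local_ring_max_ideal[OF S(1)]
    by (intro local_noetherian.intro cring_noetherian.intro local_noetherian_axioms.intro)
  have m: "maximalideal ?m R" by (rule local_ring_max_ideal(1)[OF assms(1)])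
  have im: "ideal ?m R" using m by (simp add: maximalideal_def)
  have vim_zero: "h.vim {\<zero>\<^bsub>R\<^esub>} = I" using ker by (simp add: h.vim_def)
  have vim_m: "h.vim ?m = ?n" using h.vim_maximal[OF m] L.unique_n by blast
  have In: "I \<subseteq> ?n"
    using h.S.ideal_zero[OF im] unfolding vim_zero[symmetric] vim_m[symmetric] by (auto simp: h.vim_def)
  have imm: "ideal (?m \<cdot>\<^bsub>R\<^esub> ?m) R" using im im by (rule h.S.ideal_prod_is_ideal)
  have soc: "ideal (socle R) R"
    unfolding socle_def using h.S.zeroideal h.S.ideal_subset[OF im] by (rule h.S.colon_ideal_ideal)
  have len: "ring_length R = qlength S (carrier S) I"
    unfolding ring_length_def h.qlength_vim[OF h.S.oneideal h.S.zeroideal] h.vim_carrier vim_zero ..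
  have vim_soc: "h.vim (socle R) = colon_ideal S I ?n"
    unfolding socle_def h.vim_colon_zero[OF im] vim_zero vim_m ..
  have type: "ring_type R = qlength S (colon_ideal S I ?n) I"
    unfolding ring_type_def h.qlength_vim[OF soc h.S.zeroideal] vim_soc vim_zero ..
  have two: "qlength S ?n (comb S \<one>\<^bsub>S\<^esub> I (?n \<cdot>\<^bsub>S\<^esub> ?n)) = 2"
    using assms(3) unfolding edim_def h.qlength_vim[OF im imm] h.vim_prod[OF im] vim_zero vim_m .
  have type_le: "ring_type R \<le> ring_length R"
    unfolding ring_type_def ring_length_def
    using soc h.S.zeroideal h.S.oneideal h.S.ideal_subset[OF soc] h.S.ideal_zero[OF soc]
    by (intro qlength_mono) auto
  \<comment> \<open>An infinite length satisfies neither strict inequality. A finite one bounds the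
    type, and both become natural numbers.\<close>
  show ?thesis
  proof (cases "ring_length R")
    case (enat l)
    then obtain r where r: "ring_type R = enat r" using type_le by (cases "ring_type R") auto
    have dim: "krull_dim S = qlength S ?n (?n \<cdot>\<^bsub>S\<^esub> ?n)" using S(3) by (simp add: edim_def)
    note bounds = L.burch_bounds[OF dim assms(5) In two len[symmetric, unfolded enat] type[symmetric, unfolded r]]
    show ?thesis
      using bounds unfolding enat r burch_of_presentation_def Let_def
      by (simp add: one_enat_def numeral_eq_enat)
  qed simp
qed

end
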